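(* Let $k\in\{1,2,3\}$ and $n\ge 64k^6$. Then for every simple graph $G$ (not necessarily planar) of order $n$ which does not contain $k$ pairwise edge-disjoint cycles, $\rho(G)\le \rho(K_1\nabla H)$, with equality if and only if $G\cong K_1\nabla H$, where $H$ is the disjoint union of the friendship graph $F_{k-1}$ and $n-2k$ isolated vertices.
   Context: $\rho(G)$ denotes the spectral radius of the adjacency matrix of $G$. For vertex-disjoint graphs $G_1,G_2$, the join $G_1\nabla G_2$ is obtained from their disjoint union by joining every vertex of $G_1$ to every vertex of $G_2$. The friendship graph $F_m$ ($m\ge1$) consists of $m$ triangles sharing exactly one common vertex; $F_0$ is a single isolated vertex. *)

theory Defs
  imports "Jordan_Normal_Form.Spectral_Radius"
begin

definition simple_graph :: "nat \<Rightarrow> (nat \<Rightarrow> nat \<Rightarrow> bool) \<Rightarrow> bool" where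
  "simple_graph n E \<longleftrightarrow> (\<forall>u v. E u v \<longrightarrow> u < n \<and> v < n \<and> u \<noteq> v \<and> E v u)"

text \<open>Adjacency matrix (as a complex matrix, to use the library spectral radius).\<close>
definition adj_mat :: "nat \<Rightarrow> (nat \<Rightarrow> nat \<Rightarrow> bool) \<Rightarrow> complex mat" where
  "adj_mat n E = mat n n (\<lambda>(i, j). if E i j then 1 else 0)"

definition rho :: "nat \<Rightarrow> (nat \<Rightarrow> nat \<Rightarrow> bool) \<Rightarrow> real" where
  "rho n E = spectral_radius (adj_mat n E)"

definition is_cycle :: "(nat \<Rightarrow> nat \<Rightarrow> bool) \<Rightarrow> nat list \<Rightarrow> bool" where
  "is_cycle E vs \<longleftrightarrow> length vs \<ge> 3 \<and> distinct vs \<and>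
     (\<forall>i < length vs. E (vs ! i) (vs ! ((i + 1) mod length vs)))"

definition cycle_edges :: "nat list \<Rightarrow> nat set set" where
  "cycle_edges vs = {{vs ! i, vs ! ((i + 1) mod length vs)} | i. i < length vs}"

definition has_edge_disjoint_cycles :: "(nat \<Rightarrow> nat \<Rightarrow> bool) \<Rightarrow> nat \<Rightarrow> bool" where
  "has_edge_disjoint_cycles E k \<longleftrightarrow> (\<exists>cs. length cs = k \<and> (\<forall>c \<in> set cs. is_cycle E c) \<and>
     (\<forall>i < k. \<forall>j < k. i \<noteq> j \<longrightarrow> cycle_edges (cs ! i) \<inter> cycle_edges (cs ! j) = {}))"

definition graph_iso :: "nat \<Rightarrow> (nat \<Rightarrow> nat \<Rightarrow> bool) \<Rightarrow> (nat \<Rightarrow> nat \<Rightarrow> bool) \<Rightarrow> bool" where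
  "graph_iso n E E' \<longleftrightarrow> (\<exists>f. bij_betw f {0..<n} {0..<n} \<and>
     (\<forall>u < n. \<forall>v < n. E u v \<longleftrightarrow> E' (f u) (f v)))"

text \<open>Friendship graph F_{k-1} on vertices {1..2k-1}: center 1, triangles {1,2i,2i+1}, 1<=i<=k-1.\<close>
definition friendship_edge :: "nat \<Rightarrow> nat \<Rightarrow> nat \<Rightarrow> bool" where
  "friendship_edge k u v \<longleftrightarrow>
     (u = 1 \<and> 2 \<le> v \<and> v \<le> 2 * k - 1) \<or> (v = 1 \<and> 2 \<le> u \<and> u \<le> 2 * k - 1) \<or>
     (\<exists>i. 1 \<le> i \<and> i \<le> k - 1 \<and> ({u, v} = {2 * i, 2 * i + 1}))"

text \<open>K_1 join H on {0..<n}, where vertex 0 is K_1 and H on {1..n-1} is F_{k-1}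
  (vertices 1..2k-1) plus the n-2k isolated vertices 2k..n-1.\<close>
definition extremal_graph :: "nat \<Rightarrow> nat \<Rightarrow> nat \<Rightarrow> nat \<Rightarrow> bool" where
  "extremal_graph k n u v \<longleftrightarrow> u < n \<and> v < n \<and> u \<noteq> v \<and>
     (u = 0 \<or> v = 0 \<or> friendship_edge k u v)"

end

theory Submission
  imports Defs
begin

text \<open>
  Let \<open>\<lambda>\<close> be the spectral radius of \<open>G\<close>, and scale the moduli of an eigenvector to have maximum
  1 at a vertex \<open>u\<close>. Then \<open>\<lambda>\<^sup>2\<close> is at most the weighted number of walks of length two from \<open>u\<close>. If \<open>G\<close>
  has no triangle and no 4-cycle, this is at most \<open>n - 1\<close>; so if \<open>\<lambda>\<^sup>2 > n - 1\<close>, then \<open>G\<close> has a short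
  cycle, and removing it reduces \<open>k = 3\<close> to the bound \<open>n + 3\<close> on the number of edges of a
  graph without two edge-disjoint cycles. With so few edges, a vertex not adjacent to \<open>u\<close> loses more
  walks than the edges between neighbours of \<open>u\<close> can gain. Hence \<open>u\<close> is adjacent to all other vertices,
  \<open>G\<close> is the join of \<open>u\<close> and a graph \<open>H\<close>, and
  \<open>\<lambda>\<^sup>2\<close> is \<open>n - 1 + 2 e(H) / \<lambda> + (\<Sum>\<^sub>v d(v)\<^sup>2) / \<lambda>\<^sup>2\<close> up to smaller terms. The friendship graph has
  the most edges among the admissible \<open>H\<close>, and the strictly largest sum of squared
  degrees among those with the most edges.
\<close>

section \<open>Spectral radius and subsolutions\<close>

text \<open>With \<open>m = k - 1\<close>, \<open>G\<close> and the extremal graph meet in one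
  scalar function: \<open>r^2\<close> is compared with
  \<open>n - 1 + 6 m / r + 4 m (m + 2) / r^2\<close>, where \<open>6 m\<close> and
  \<open>4 m (m + 2)\<close> are the sums of degrees and of squared degrees of \<open>F_m\<close>.
  For the extremal graph an explicit nonnegative vector with \<open>r y <= A y\<close> certifies
  \<open>r <= rho\<close>, so its spectral radius is never computed. The second-order term cannot be
  dropped: for \<open>k = 3\<close> there are other admissible \<open>H\<close> with six edges, such
  as \<open>K_{2,3}\<close>, whose squared degrees sum to 30 against 32 for \<open>F_2\<close>. The
  obstacle is that \<open>lam\<close> has only the order of \<open>sqrt n\<close>. Small entries of
  the eigenvector are of order \<open>1 / lam\<close> and help only against constants, so the number
  of edges must be known up to a constant before a non-neighbour of \<open>u\<close> can be
  excluded. The lower bound on \<open>n\<close> serves chiefly to give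
  \<open>lam >= 7, 63, 215\<close> for \<open>k = 1, 2, 3\<close>, just below \<open>8 k^3\<close>,
  which beats the constants that arise.\<close>

definition nbs :: "(nat \<Rightarrow> nat \<Rightarrow> bool) \<Rightarrow> nat \<Rightarrow> nat set" where
  "nbs G v = {w. G v w}"

lemma nbs_subset: "simple_graph n G \<Longrightarrow> nbs G v \<subseteq> {..<n} - {v}"
  by (auto simp: simple_graph_def nbs_def)

lemma finite_nbs: "simple_graph n G \<Longrightarrow> finite (nbs G v)"
  by (rule finite_subset[OF nbs_subset]) auto

lemma mult_mat_vec_adj_mat:
  assumes "simple_graph n G" "v < n" "dim_vec z = n"
  shows "(adj_mat n G *\<^sub>v z) $ v = (\<Sum>w\<in>nbs G v. z $ w)"
proof -
  have "(adj_mat n G *\<^sub>v z) $ v = (\<Sum>w\<in>{0..<n}. if w \<in> nbs G v then z $ w else 0)"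
    using assms by (auto simp: adj_mat_def scalar_prod_def nbs_def intro!: sum.cong)
  also have "\<dots> = (\<Sum>w\<in>{0..<n} \<inter> nbs G v. z $ w)"
    by (simp add: sum.inter_restrict)
  also have "{0..<n} \<inter> nbs G v = nbs G v"
    using nbs_subset[OF assms(1), of v] by auto
  finally show ?thesis .
qed

lemma adj_mat_carrier [simp]: "adj_mat n G \<in> carrier_mat n n"
  by (simp add: adj_mat_def)

text \<open>An eigenvalue of maximal modulus and its eigenvector may be complex; the triangle
  inequality makes the moduli of the entries a nonnegative subsolution, which is then divided by its
  largest entry.\<close>

lemma rho_le_nbs_sum:
  assumes G: "simple_graph n G" and n: "n > 0"
  obtains x :: "nat \<Rightarrow> real" and u where "u < n" "x u = 1" "\<And>v. v < n \<Longrightarrow> 0 \<le> x v"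
    "\<And>v. v < n \<Longrightarrow> x v \<le> 1" "\<And>v. v < n \<Longrightarrow> rho n G * x v \<le> (\<Sum>w\<in>nbs G v. x w)"
proof -
  obtain \<mu> where "eigenvalue (adj_mat n G) \<mu>" and rho: "rho n G = norm \<mu>"
    using spectral_radius_mem_max(1)[OF adj_mat_carrier n] by (auto simp: rho_def spectrum_def)
  then obtain z where z: "z \<in> carrier_vec n" "z \<noteq> 0\<^sub>v n" "adj_mat n G *\<^sub>v z = \<mu> \<cdot>\<^sub>v z"
    by (auto simp: eigenvalue_def eigenvector_def adj_mat_def)
  define M where "M = Max ((\<lambda>v. norm (z $ v)) ` {..<n})"
  have "M \<in> (\<lambda>v. norm (z $ v)) ` {..<n}"
    unfolding M_def by (rule Max_in) (use n in auto)
  then obtain u where u: "u < n" "M = norm (z $ u)" by auto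
  have le: "norm (z $ v) \<le> M" if "v < n" for v
    unfolding M_def using that by auto
  have "M > 0"
  proof (rule ccontr)
    assume "\<not> M > 0"
    have "z $ v = 0" if "v < n" for v
      using le[OF that] \<open>\<not> M > 0\<close> norm_ge_zero[of "z $ v"]
      by (metis dual_order.strict_trans1 zero_less_norm_iff)
    then have "z = 0\<^sub>v n" using z(1) by (intro eq_vecI) auto
    with z(2) show False by contradiction
  qed
  have sub: "rho n G * norm (z $ v) \<le> (\<Sum>w\<in>nbs G v. norm (z $ w))" if "v < n" for v
  proof -
    have "rho n G * norm (z $ v) = norm ((adj_mat n G *\<^sub>v z) $ v)"
      using z that by (simp add: rho norm_mult)
    also have "(adj_mat n G *\<^sub>v z) $ v = (\<Sum>w\<in>nbs G v. z $ w)"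
      using mult_mat_vec_adj_mat[OF G that, of z] z(1) by auto
    also have "norm \<dots> \<le> (\<Sum>w\<in>nbs G v. norm (z $ w))" by (rule norm_sum)
    finally show ?thesis .
  qed
  show thesis
  proof (rule that[of u "\<lambda>v. norm (z $ v) / M"])
    fix v assume "v < n"
    then show "rho n G * (norm (z $ v) / M) \<le> (\<Sum>w\<in>nbs G v. norm (z $ w) / M)"
      using sub[of v] \<open>M > 0\<close> by (simp add: sum_divide_distrib[symmetric] divide_right_mono)
  next
    fix v assume "v < n"
    then show "norm (z $ v) / M \<le> 1" using le[of v] \<open>M > 0\<close> by simp
  qed (use u \<open>M > 0\<close> in simp_all)
qed

lemma rho_nonneg:
  assumes "simple_graph n G" "n > 0"
  shows "0 \<le> rho n G"
  using spectral_radius_mem_max(1)[OF adj_mat_carrier[of n G] assms(2)] by (auto simp: rho_def)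

lemma spectral_radius_smult_less_1:
  assumes A: "A \<in> carrier_mat n n" and n: "n > 0" and t: "spectral_radius A < t" "t > 0"
  shows "spectral_radius (complex_of_real (1 / t) \<cdot>\<^sub>m A) < 1"
proof -
  let ?B = "complex_of_real (1 / t) \<cdot>\<^sub>m A"
  have B: "?B \<in> carrier_mat n n" using A by auto
  obtain \<mu> where "eigenvalue ?B \<mu>" and mu: "spectral_radius ?B = norm \<mu>"
    using spectral_radius_mem_max(1)[OF B n] by (auto simp: spectrum_def)
  then obtain z where z: "z \<in> carrier_vec n" "z \<noteq> 0\<^sub>v n" "?B *\<^sub>v z = \<mu> \<cdot>\<^sub>v z"
    using A by (auto simp: eigenvalue_def eigenvector_def)
  have "A *\<^sub>v z = complex_of_real t \<cdot>\<^sub>v (?B *\<^sub>v z)"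
    using A z(1) t by (intro eq_vecI) (auto simp: field_simps)
  also have "\<dots> = (complex_of_real t * \<mu>) \<cdot>\<^sub>v z"
    using z by (simp add: smult_smult_assoc)
  finally have "eigenvalue A (complex_of_real t * \<mu>)"
    using A z by (auto simp: eigenvalue_def eigenvector_def)
  then have "norm (complex_of_real t * \<mu>) \<le> spectral_radius A"
    by (intro spectral_radius_mem_max(2)[OF A n]) (simp add: spectrum_def)
  then have "t * norm \<mu> \<le> spectral_radius A" using t by (simp add: norm_mult)
  then have "t * norm \<mu> < t * 1" using t by linarith
  then have "norm \<mu> < 1" using mult_less_cancel_left_pos[OF t(2), of "norm \<mu>" 1] by blast
  then show ?thesis using mu by simp
qed

text \<open>A Collatz-Wielandt lower bound. If \<open>rho < t < r\<close>, then \<open>A / t\<close>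
  has spectral radius below 1, so its powers have bounded entries; but iterating the subsolution
  inequality makes the entry at \<open>u\<close> of these powers applied to \<open>y\<close> grow at
  least like \<open>(r / t) ^ k\<close>.\<close>

lemma le_rhoI:
  assumes G: "simple_graph n G"
    and y: "\<And>v. v < n \<Longrightarrow> 0 \<le> y v" and u: "u < n" "y u > 0"
    and sub: "\<And>v. v < n \<Longrightarrow> r * y v \<le> (\<Sum>w\<in>nbs G v. y w)"
  shows "r \<le> rho n G"
proof (rule ccontr)
  assume "\<not> r \<le> rho n G"
  then obtain t where t: "rho n G < t" "t < r" using dense[of "rho n G" r] by auto
  have n: "n > 0" using u by auto
  have t0: "t > 0" using rho_nonneg[OF G n] t by linarith
  define B where "B = complex_of_real (1 / t) \<cdot>\<^sub>m adj_mat n G"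
  have Bc: "B \<in> carrier_mat n n" by (simp add: B_def)
  have "spectral_radius B < 1"
    unfolding B_def using t t0 n by (intro spectral_radius_smult_less_1) (auto simp: rho_def)
  then obtain c where c: "\<And>k. norm_bound (B ^\<^sub>m k) c"
    using spectral_radius_jnf_norm_bound_less_1_upper_triangular[OF Bc] by auto
  define T where "T = (\<lambda>x v. (1 / t) * (\<Sum>w\<in>nbs G v. x w :: real))"
  define V where "V = (\<lambda>x. vec n (\<lambda>v. complex_of_real (x v)))"
  have BV: "B *\<^sub>v V x = V (T x)" for x
  proof (rule eq_vecI)
    fix v assume "v < dim_vec (V (T x))"
    then have v: "v < n" by (simp add: V_def)
    have "(B *\<^sub>v V x) $ v = complex_of_real (1 / t) * (adj_mat n G *\<^sub>v V x) $ v"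
      using v by (simp add: B_def V_def smult_scalar_prod_distrib adj_mat_def)
    also have "\<dots> = V (T x) $ v"
      using v nbs_subset[OF G, of v]
      by (subst mult_mat_vec_adj_mat[OF G v]) (auto simp: V_def T_def sum_divide_distrib intro!: sum.cong)
    finally show "(B *\<^sub>v V x) $ v = V (T x) $ v" .
  qed (simp add: V_def B_def adj_mat_def)
  have pow: "B ^\<^sub>m k *\<^sub>v V x = V ((T ^^ k) x)" for k x
  proof (induction k arbitrary: x)
    case 0
    show ?case using Bc by (simp add: V_def)
  next
    case (Suc k)
    have "B ^\<^sub>m Suc k *\<^sub>v V x = B ^\<^sub>m k *\<^sub>v (B *\<^sub>v V x)"
      using Bc by (simp add: V_def assoc_mult_mat_vec[OF pow_carrier_mat[OF Bc] Bc])
    then show ?case by (simp add: BV Suc.IH funpow_swap1)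
  qed
  have ge: "\<forall>v<n. (r / t) ^ k * y v \<le> (T ^^ k) y v" for k
  proof (induction k)
    case (Suc k)
    show ?case
    proof (intro allI impI)
      fix v assume v: "v < n"
      have "(r / t) ^ Suc k * y v = (1 / t) * ((r / t) ^ k * (r * y v))" by simp
      also have "\<dots> \<le> (1 / t) * ((r / t) ^ k * (\<Sum>w\<in>nbs G v. y w))"
        using t t0 sub[OF v] by (intro mult_left_mono) auto
      also have "\<dots> = (1 / t) * (\<Sum>w\<in>nbs G v. (r / t) ^ k * y w)"
        by (simp add: sum_distrib_left)
      also have "\<dots> \<le> (1 / t) * (\<Sum>w\<in>nbs G v. (T ^^ k) y w)"
        using Suc nbs_subset[OF G, of v] t0 by (intro mult_left_mono sum_mono) auto
      finally show "(r / t) ^ Suc k * y v \<le> (T ^^ Suc k) y v" by (simp add: T_def)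
    qed
  qed simp
  have bound: "(r / t) ^ k * y u \<le> (\<Sum>w<n. c * y w)" for k
  proof -
    have "(r / t) ^ k * y u \<le> (T ^^ k) y u" using ge u by auto
    also have "\<dots> \<le> norm (complex_of_real ((T ^^ k) y u))" by simp
    also have "complex_of_real ((T ^^ k) y u) = (B ^\<^sub>m k *\<^sub>v V y) $ u"
      using u by (simp add: pow) (simp add: V_def)
    also have "\<dots> = (\<Sum>w\<in>{0..<n}. (B ^\<^sub>m k) $$ (u, w) * complex_of_real (y w))"
      using u(1) carrier_matD[OF pow_carrier_mat[OF Bc, of k]]
      by (simp add: scalar_prod_def V_def)
    also have "norm \<dots> \<le> (\<Sum>w\<in>{0..<n}. norm ((B ^\<^sub>m k) $$ (u, w) * complex_of_real (y w)))"
      by (rule norm_sum)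
    also have "\<dots> \<le> (\<Sum>w\<in>{0..<n}. c * y w)"
    proof (rule sum_mono)
      fix w assume w: "w \<in> {0..<n}"
      have "norm ((B ^\<^sub>m k) $$ (u, w)) \<le> c"
        using c[of k] u(1) w carrier_matD[OF pow_carrier_mat[OF Bc, of k]]
        unfolding norm_bound_def by (metis atLeastLessThan_iff)
      then show "norm ((B ^\<^sub>m k) $$ (u, w) * complex_of_real (y w)) \<le> c * y w"
        using y[of w] w by (simp add: norm_mult mult_right_mono)
    qed
    finally show ?thesis by (simp add: atLeast0LessThan)
  qed
  have "1 < r / t" using t t0 by simp
  then obtain k where "(\<Sum>w<n. c * y w) / y u < (r / t) ^ k"
    using real_arch_pow by blast
  with bound[of k] u show False by (simp add: field_simps)
qed

text \<open>The subsolution of \<open>G\<close> is carried to \<open>H\<close> by the inverse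
  bijection and fed to \<open>le_rhoI\<close>; the symmetry of isomorphism later yields
  equality.\<close>

lemma rho_le_graph_iso:
  assumes G: "simple_graph n G" and H: "simple_graph n H" and n: "n > 0"
    and iso: "graph_iso n G H"
  shows "rho n G \<le> rho n H"
proof -
  obtain x :: "nat \<Rightarrow> real" and u where x: "u < n" "x u = 1" "\<And>v. v < n \<Longrightarrow> 0 \<le> x v"
    "\<And>v. v < n \<Longrightarrow> rho n G * x v \<le> (\<Sum>w\<in>nbs G v. x w)"
    using rho_le_nbs_sum[OF G n] by metis
  obtain f where f: "bij_betw f {0..<n} {0..<n}" "\<And>u v. u < n \<Longrightarrow> v < n \<Longrightarrow> G u v \<longleftrightarrow> H (f u) (f v)"
    using iso by (auto simp: graph_iso_def)
  define g where "g = inv_into {0..<n} f"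
  have g: "g v < n" "f (g v) = v" if "v < n" for v
    using that bij_betwE[OF bij_betw_inv_into[OF f(1)]] bij_betw_inv_into_right[OF f(1)] by (auto simp: g_def)
  have gf: "g (f v) = v" "f v < n" if "v < n" for v
    using that bij_betwE[OF f(1)] bij_betw_inv_into_left[OF f(1)] by (auto simp: g_def)
  show ?thesis
  proof (rule le_rhoI[OF H, of "x \<circ> g" "f u"])
    fix v assume v: "v < n"
    have "w < n \<and> H v (f w)" if "G (g v) w" for w
    proof -
      have "w < n" using that G by (auto simp: simple_graph_def)
      then show ?thesis using that f(2)[of "g v" w] g v by auto
    qed
    moreover have "w < n \<and> G (g v) (g w)" if "H v w" for w
    proof -
      have "w < n" using that H by (auto simp: simple_graph_def)
      then show ?thesis using that f(2)[of "g v" "g w"] g v by auto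
    qed
    ultimately have "(\<Sum>w\<in>nbs G (g v). x w) = (\<Sum>w\<in>nbs H v. (x \<circ> g) w)"
      using g gf by (intro sum.reindex_bij_witness[of _ g f]) (auto simp: nbs_def)
    then show "rho n G * (x \<circ> g) v \<le> (\<Sum>w\<in>nbs H v. (x \<circ> g) w)"
      using x(4)[OF g(1)[OF v]] by simp
  qed (use x g gf in auto)
qed

lemma graph_iso_sym:
  assumes "graph_iso n G H"
  shows "graph_iso n H G"
proof -
  obtain f where f: "bij_betw f {0..<n} {0..<n}" "\<forall>u<n. \<forall>v<n. G u v \<longleftrightarrow> H (f u) (f v)"
    using assms by (auto simp: graph_iso_def)
  have g: "bij_betw (inv_into {0..<n} f) {0..<n} {0..<n}"
    using f(1) by (rule bij_betw_inv_into)
  have "inv_into {0..<n} f v < n" "f (inv_into {0..<n} f v) = v" if "v < n" for v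
    using that bij_betwE[OF g] bij_betw_inv_into_right[OF f(1)] by auto
  then have "\<forall>u<n. \<forall>v<n. H u v \<longleftrightarrow> G (inv_into {0..<n} f u) (inv_into {0..<n} f v)"
    using f(2) by simp
  with g show ?thesis unfolding graph_iso_def by blast
qed

lemma rho_graph_iso:
  assumes "simple_graph n G" "simple_graph n H" "n > 0" "graph_iso n G H"
  shows "rho n G = rho n H"
  using assms graph_iso_sym[OF assms(4)] by (intro antisym rho_le_graph_iso)

section \<open>Packing edge-disjoint cycles\<close>

text \<open>Nonempty edge sets (as symmetric relations) without vertices of degree one take the place of
  cycles: each contains a cycle, and packing them needs only set operations.\<close>

definition leafless :: "('a \<times> 'a) set \<Rightarrow> bool" where
  "leafless F \<longleftrightarrow> finite F \<and> F \<noteq> {} \<and> sym F \<and> irrefl F \<and>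
     (\<forall>a b. (a, b) \<in> F \<longrightarrow> (\<exists>c. c \<noteq> a \<and> (b, c) \<in> F))"

fun packs :: "nat \<Rightarrow> ('a \<times> 'a) set \<Rightarrow> bool" where
  "packs 0 E \<longleftrightarrow> True"
| "packs (Suc k) E \<longleftrightarrow> (\<exists>F\<subseteq>E. leafless F \<and> packs k (E - F))"

lemma packs_mono: "packs k E \<Longrightarrow> E \<subseteq> E' \<Longrightarrow> packs k E'"
proof (induction k arbitrary: E E')
  case (Suc k)
  then obtain F where F: "F \<subseteq> E" "leafless F" "packs k (E - F)" by auto
  with Suc.IH[OF F(3), of "E' - F"] Suc.prems(2) show ?case by auto
qed simp

lemma packs_2I:
  assumes "leafless A" "leafless B" "A \<subseteq> E" "B \<subseteq> E" "A \<inter> B = {}"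
  shows "packs 2 E"
proof -
  have "B \<subseteq> E - A" using assms by auto
  then show ?thesis using assms(1-3) by (auto simp: numeral_2_eq_2)
qed

lemma packs_SucI:
  assumes "leafless A" "A \<subseteq> E" "packs k E'" "E' \<subseteq> E - A"
  shows "packs (Suc k) E"
  using assms packs_mono[OF assms(3,4)] by auto

lemma packs_3I:
  assumes "leafless A" "leafless B" "leafless C" "A \<subseteq> E" "B \<subseteq> E" "C \<subseteq> E"
    "A \<inter> B = {}" "A \<inter> C = {}" "B \<inter> C = {}"
  shows "packs 3 E"
proof -
  have "packs 2 (E - A)" using assms by (intro packs_2I[of B C]) auto
  then show ?thesis using packs_SucI[OF assms(1,4), of 2 "E - A"] by (simp add: numeral_3_eq_3 numeral_2_eq_2)
qed

text \<open>The first vertex of a longest path has a neighbour other than its successor. By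
  maximality that neighbour lies on the path, at position 2 or later, and so closes a cycle of
  length at least three.\<close>

lemma leafless_imp_cycle:
  assumes "leafless F"
  obtains c where "is_cycle (\<lambda>a b. (a, b) \<in> F) c"
proof -
  define P where "P = (\<lambda>p. distinct p \<and> length p \<ge> 2 \<and> (\<forall>i. Suc i < length p \<longrightarrow> (p ! i, p ! Suc i) \<in> F))"
  have fin: "finite (Field F)" using assms by (simp add: leafless_def finite_Field)
  have sub: "set p \<subseteq> Field F" if "P p" for p
  proof
    fix v assume "v \<in> set p"
    then obtain i where i: "i < length p" "v = p ! i" by (auto simp: in_set_conv_nth)
    show "v \<in> Field F"
    proof (cases "Suc i < length p")
      case True
      then show ?thesis using that i by (auto simp: P_def intro: FieldI1)
    next
      case False
      then have "Suc (i - 1) < length p" "Suc (i - 1) = i" using that i by (auto simp: P_def)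
      then show ?thesis using that i unfolding P_def by (metis FieldI2)
    qed
  qed
  have bound: "\<forall>p. P p \<longrightarrow> length p < Suc (card (Field F))"
    using sub card_mono[OF fin] by (auto simp: P_def less_Suc_eq_le distinct_card[symmetric])
  obtain a b where "(a, b) \<in> F" using assms by (auto simp: leafless_def)
  then have "P [a, b]" using assms by (auto simp: P_def leafless_def irrefl_def)
  then obtain p where p: "P p" and max: "\<And>q. P q \<Longrightarrow> length q \<le> length p"
    using ex_has_greatest_nat[OF _ bound] by blast
  obtain v w r where vw: "p = v # w # r"
    using p by (cases p rule: remdups_adj.cases) (auto simp: P_def)
  have "(v, w) \<in> F" using p by (auto simp: P_def vw)
  then have "(w, v) \<in> F" using assms by (auto simp: leafless_def dest: symD)
  then obtain c where c: "c \<noteq> w" "(v, c) \<in> F" using assms by (auto simp: leafless_def)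
  then have cv: "(c, v) \<in> F" "c \<noteq> v" using assms by (auto simp: leafless_def irrefl_def dest: symD)
  have "c \<in> set p"
  proof (rule ccontr)
    assume "c \<notin> set p"
    then have "P (c # p)" using p cv by (auto simp: P_def nth_Cons vw split: nat.split)
    from max[OF this] show False by simp
  qed
  then obtain j where j: "j < length p" "p ! j = c" by (auto simp: in_set_conv_nth)
  have "j \<noteq> 0" using j(2) cv(2) vw by (metis nth_Cons_0)
  moreover have "j \<noteq> 1" using j(2) c(1) vw by auto
  ultimately have j2: "j \<ge> 2" by simp
  show thesis
  proof (rule that[of "take (Suc j) p"])
    have len: "length (take (Suc j) p) = Suc j" using j by simp
    have "(take (Suc j) p ! i, take (Suc j) p ! ((i + 1) mod Suc j)) \<in> F" if "i < Suc j" for i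
    proof (cases "i = j")
      case True
      have "p ! 0 = v" using vw by simp
      then show ?thesis using True cv j by simp
    next
      case False
      then show ?thesis using that p j by (auto simp: P_def)
    qed
    then show "is_cycle (\<lambda>a b. (a, b) \<in> F) (take (Suc j) p)"
      unfolding is_cycle_def len using p j2 by (auto simp: P_def)
  qed
qed

lemma packs_imp_edge_disjoint_cycles:
  assumes "packs k E" "\<And>a b. (a, b) \<in> E \<Longrightarrow> G a b"
  shows "has_edge_disjoint_cycles G k"
proof -
  have "\<exists>cs. length cs = k \<and> (\<forall>c\<in>set cs. is_cycle (\<lambda>a b. (a, b) \<in> E) c) \<and>
     (\<forall>i<k. \<forall>j<k. i \<noteq> j \<longrightarrow> cycle_edges (cs ! i) \<inter> cycle_edges (cs ! j) = {})"
    using assms(1)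
  proof (induction k arbitrary: E)
    case (Suc k)
    then obtain F where F: "F \<subseteq> E" "leafless F" "packs k (E - F)" by auto
    obtain c where c: "is_cycle (\<lambda>a b. (a, b) \<in> F) c" using leafless_imp_cycle[OF F(2)] .
    obtain cs where cs: "length cs = k" "\<forall>c\<in>set cs. is_cycle (\<lambda>a b. (a, b) \<in> E - F) c"
      "\<forall>i<k. \<forall>j<k. i \<noteq> j \<longrightarrow> cycle_edges (cs ! i) \<inter> cycle_edges (cs ! j) = {}"
      using Suc.IH[OF F(3)] by auto
    have "cycle_edges c \<inter> cycle_edges d = {}" if "d \<in> set cs" for d
    proof (rule ccontr)
      assume "cycle_edges c \<inter> cycle_edges d \<noteq> {}"
      then obtain i j where ij: "i < length c" "j < length d"
        "{c ! i, c ! ((i + 1) mod length c)} = {d ! j, d ! ((j + 1) mod length d)}"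
        by (auto simp: cycle_edges_def)
      then have 1: "(c ! i, c ! ((i + 1) mod length c)) \<in> F" "(d ! j, d ! ((j + 1) mod length d)) \<in> E - F"
        using c cs(2) that by (auto simp: is_cycle_def)
      \<comment> \<open>The two cycles may traverse a common edge in opposite directions, so the
        symmetry of \<open>F\<close> is what transfers membership.\<close>
      then have "(d ! j, d ! ((j + 1) mod length d)) \<in> F"
        using ij(3) F(2) by (auto simp: doubleton_eq_iff leafless_def dest: symD)
      with 1 show False by simp
    qed
    then have "cycle_edges c \<inter> cycle_edges (cs ! i) = {}" if "i < k" for i
      using that cs(1) by simp
    then have "\<forall>i<Suc k. \<forall>j<Suc k. i \<noteq> j \<longrightarrow> cycle_edges ((c # cs) ! i) \<inter> cycle_edges ((c # cs) ! j) = {}"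
      using cs(3) by (simp add: All_less_Suc2 Int_commute)
    moreover have "\<forall>c\<in>set (c # cs). is_cycle (\<lambda>a b. (a, b) \<in> E) c"
      using c cs(2) F(1) by (auto simp: is_cycle_def)
    ultimately show ?case using cs(1) by (intro exI[of _ "c # cs"]) simp
  qed simp
  then show ?thesis
    using assms(2) unfolding has_edge_disjoint_cycles_def is_cycle_def by metis
qed

text \<open>Both orientations are listed, as in every edge relation here: cardinalities are twice
  the numbers of edges, and a bound of 8 admits exactly the cycles of length 3 and 4.\<close>

definition tri :: "'a \<Rightarrow> 'a \<Rightarrow> 'a \<Rightarrow> ('a \<times> 'a) set" where
  "tri a b c = {(a, b), (b, a), (b, c), (c, b), (a, c), (c, a)}"

definition quad :: "'a \<Rightarrow> 'a \<Rightarrow> 'a \<Rightarrow> 'a \<Rightarrow> ('a \<times> 'a) set" where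
  "quad a b c d = {(a, b), (b, a), (b, c), (c, b), (c, d), (d, c), (d, a), (a, d)}"

lemma leafless_tri:
  assumes "distinct [a, b, c]"
  shows "leafless (tri a b c)"
proof -
  have ne: "a \<noteq> b" "a \<noteq> c" "b \<noteq> a" "b \<noteq> c" "c \<noteq> a" "c \<noteq> b"
    using assms by auto
  have "\<exists>r\<in>{a, b, c}. r \<noteq> p \<and> (q, r) \<in> tri a b c" if "(p, q) \<in> tri a b c" for p q
    using that unfolding tri_def by (elim insertE emptyE) (simp_all add: ne)
  moreover have "sym (tri a b c)" by (auto simp: sym_def tri_def)
  moreover have "irrefl (tri a b c)" by (auto simp: irrefl_def tri_def ne)
  moreover have "finite (tri a b c)" "tri a b c \<noteq> {}" by (simp_all add: tri_def quad_def)
  ultimately show ?thesis unfolding leafless_def by blast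
qed

lemma leafless_quad:
  assumes "distinct [a, b, c, d]"
  shows "leafless (quad a b c d)"
proof -
  have ne: "a \<noteq> b" "a \<noteq> c" "a \<noteq> d" "b \<noteq> a" "b \<noteq> c" "b \<noteq> d" "c \<noteq> a" "c \<noteq> b" "c \<noteq> d" "d \<noteq> a" "d \<noteq> b" "d \<noteq> c"
    using assms by auto
  have "\<exists>r\<in>{a, b, c, d}. r \<noteq> p \<and> (q, r) \<in> quad a b c d" if "(p, q) \<in> quad a b c d" for p q
    using that unfolding quad_def by (elim insertE emptyE) (simp_all add: ne)
  moreover have "sym (quad a b c d)" by (auto simp: sym_def quad_def)
  moreover have "irrefl (quad a b c d)" by (auto simp: irrefl_def quad_def ne)
  moreover have "finite (quad a b c d)" "quad a b c d \<noteq> {}" by (simp_all add: tri_def quad_def)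
  ultimately show ?thesis unfolding leafless_def by blast
qed

lemma card_tri_le: "card (tri a b c) \<le> 6"
  using card_length[of "[(a, b), (b, a), (b, c), (c, b), (a, c), (c, a)]"] by (simp add: tri_def)

lemma card_quad_le: "card (quad a b c d) \<le> 8"
  using card_length[of "[(a, b), (b, a), (b, c), (c, b), (c, d), (d, c), (d, a), (a, d)]"]
  by (simp add: quad_def)

section \<open>Edge counts that force one or two edge-disjoint cycles\<close>

lemma card_eq_sum_degrees:
  assumes "finite V" "E \<subseteq> V \<times> V"
  shows "card E = (\<Sum>v\<in>V. card (E `` {v}))"
proof -
  have "E = Sigma V (\<lambda>v. E `` {v})" using assms by auto
  moreover have "finite (E `` {v})" for v using assms by (auto intro: finite_subset[of _ V])
  ultimately show ?thesis using card_SigmaI[OF assms(1), of "\<lambda>v. E `` {v}"] by simp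
qed

lemma card_delete_vertex:
  assumes "finite V" "E \<subseteq> V \<times> V" "sym E" "irrefl E"
  shows "card E = card (E \<inter> (V - {v}) \<times> (V - {v})) + 2 * card (E `` {v})"
proof -
  let ?A = "E \<inter> (V - {v}) \<times> (V - {v})" and ?B = "{v} \<times> E `` {v}" and ?C = "E `` {v} \<times> {v}"
  have fin: "finite (E `` {v})" using assms by (auto intro: finite_subset[of _ V])
  have "E = ?A \<union> (?B \<union> ?C)" using assms by (auto dest: symD)
  moreover have "card (?A \<union> (?B \<union> ?C)) = card ?A + card (?B \<union> ?C)"
    using assms fin by (intro card_Un_disjoint) auto
  moreover have "card (?B \<union> ?C) = card ?B + card ?C"
    using assms fin by (intro card_Un_disjoint) (auto simp: irrefl_def)
  ultimately show ?thesis by (simp add: card_cartesian_product)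
qed

lemma card_ge_2_obtain:
  assumes "2 \<le> card A"
  obtains b where "b \<in> A" "b \<noteq> a"
proof -
  have "\<not> A \<subseteq> {a}"
    using card_mono[of "{a}" A] assms by auto
  then show thesis using that by auto
qed

text \<open>Deleting a vertex of degree at most one takes at most 2 from \<open>card E\<close>. A
  single vertex cannot carry the required edge, so the deletions end at a graph of minimum degree
  two, which is itself leafless. The \<open>+ 1\<close> lets the contrapositive give the forest
  bound \<open>card E <= 2 * (card V - 1)\<close> without a parity argument.\<close>

lemma leafless_if_many_edges:
  assumes "finite V" "E \<subseteq> V \<times> V" "sym E" "irrefl E" "2 * card V \<le> card E + 1" "V \<noteq> {}"
  shows "\<exists>F\<subseteq>E. leafless F"
  using assms
proof (induction "card V" arbitrary: V E rule: less_induct)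
  case less
  have finE: "finite E" using less.prems by (auto intro: finite_subset)
  show ?case
  proof (cases "\<exists>v\<in>V. card (E `` {v}) \<le> 1")
    case True
    then obtain v where v: "v \<in> V" "card (E `` {v}) \<le> 1" by auto
    let ?E = "E \<inter> (V - {v}) \<times> (V - {v})"
    have c: "card E \<le> card ?E + 2" using card_delete_vertex[OF less.prems(1-4), of v] v by simp
    have cV: "card V = Suc (card (V - {v}))" using less.prems v by (metis card.remove)
    show ?thesis
    proof (cases "V - {v} = {}")
      case True
      then have "E \<subseteq> {v} \<times> {v}" using less.prems v by blast
      then have "E = {}" using less.prems(4) by (auto simp: irrefl_def)
      then show ?thesis using less.prems(5) cV by simp
    next
      case False
      have "\<exists>F\<subseteq>?E. leafless F"
        using less.prems c cV False
        by (intro less.hyps[of "V - {v}"]) (auto simp: sym_def irrefl_def)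
      then show ?thesis by blast
    qed
  next
    case False
    then have deg: "2 \<le> card (E `` {v})" if "v \<in> V" for v using that by force
    have "E \<noteq> {}" using deg less.prems(6) by fastforce
    moreover have "\<exists>c. c \<noteq> a \<and> (b, c) \<in> E" if "(a, b) \<in> E" for a b
    proof -
      have "b \<in> V" using that less.prems by auto
      from deg[OF this] obtain c where "c \<in> E `` {b}" "c \<noteq> a" by (rule card_ge_2_obtain)
      then show ?thesis by auto
    qed
    ultimately have "leafless E" using less.prems finE by (simp add: leafless_def)
    then show ?thesis by blast
  qed
qed

lemma packs_2_if_small_cycle:
  assumes "finite V" "E \<subseteq> V \<times> V" "sym E" "irrefl E" "V \<noteq> {}"
    and F: "leafless F" "F \<subseteq> E" "2 * card V + card F \<le> card E + 1"
  shows "packs 2 E"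
proof -
  have finE: "finite E" using assms by (auto intro: finite_subset)
  have "\<exists>F'\<subseteq>E - F. leafless F'"
    using assms finE F(1)
    by (intro leafless_if_many_edges[of V])
       (auto simp: card_Diff_subset leafless_def sym_def irrefl_def)
  then show ?thesis using F by (auto simp: numeral_2_eq_2)
qed

text \<open>This undoes the suppression of a vertex of degree two in the induction of
  \<open>packs_2_if_many_edges\<close>.\<close>

lemma leafless_subdivide:
  assumes F: "leafless F" "(a, b) \<in> F" and v: "v \<notin> Field F"
  shows "leafless (F - {(a, b), (b, a)} \<union> {(a, v), (v, a), (b, v), (v, b)})" (is "leafless ?F'")
proof -
  have s: "(q, p) \<in> F" if "(p, q) \<in> F" for p q using F that by (auto simp: leafless_def dest: symD)
  have ir: "(p, p) \<notin> F" for p using F by (auto simp: leafless_def irrefl_def)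
  have ext: "\<exists>c. c \<noteq> p \<and> (q, c) \<in> F" if "(p, q) \<in> F" for p q using F that by (auto simp: leafless_def)
  have nv: "p \<noteq> v" "q \<noteq> v" if "(p, q) \<in> F" for p q using v that by (auto simp: Field_def)
  have ba: "(b, a) \<in> F" using s[OF F(2)] .
  have "\<exists>c. c \<noteq> p \<and> (q, c) \<in> ?F'" if pq: "(p, q) \<in> ?F'" for p q
  proof -
    consider "(p, q) \<in> F - {(a, b), (b, a)}" | "p = a" "q = v" | "p = v" "q = a" | "p = b" "q = v" | "p = v" "q = b"
      using pq by blast
    then show ?thesis
    proof cases
      case 1
      then obtain c where c: "c \<noteq> p" "(q, c) \<in> F" using ext by auto
      show ?thesis
      proof (cases "(q, c) = (a, b) \<or> (q, c) = (b, a)")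
        case True
        then show ?thesis using nv 1 by (intro exI[of _ v]) auto
      next
        case False
        then show ?thesis using c by auto
      qed
    next
      case 2
      then show ?thesis using ir F by (intro exI[of _ b]) auto
    next
      case 3
      obtain c where "c \<noteq> b" "(a, c) \<in> F" using ext[OF ba] by auto
      then show ?thesis using 3 nv ir F by (intro exI[of _ c]) auto
    next
      case 4
      then show ?thesis using ir F by (intro exI[of _ a]) auto
    next
      case 5
      obtain c where "c \<noteq> a" "(b, c) \<in> F" using ext[OF F(2)] by auto
      then show ?thesis using 5 nv ir F by (intro exI[of _ c]) auto
    qed
  qed
  moreover have "finite ?F'" using F by (simp add: leafless_def)
  moreover have "sym ?F'" using s by (auto simp: sym_def)
  moreover have "irrefl ?F'" using ir nv[OF F(2)] by (auto simp: irrefl_def)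
  ultimately show ?thesis unfolding leafless_def by blast
qed

text \<open>Without triangles and 4-cycles every vertex other than \<open>v\<close> is the end of at most one walk of
  length two from \<open>v\<close>, and of none if it is a neighbour of \<open>v\<close>.\<close>

lemma sum_walks2_le:
  fixes x :: "'a \<Rightarrow> real"
  assumes "finite V" "E \<subseteq> V \<times> V" "sym E" "irrefl E" "v \<in> V"
    and x: "\<And>w. w \<in> V \<Longrightarrow> 0 \<le> x w" "\<And>w. w \<in> V \<Longrightarrow> x w \<le> 1"
    and tri: "\<And>a b c. distinct [a, b, c] \<Longrightarrow> \<not> tri a b c \<subseteq> E"
    and quad: "\<And>a b c d. distinct [a, b, c, d] \<Longrightarrow> \<not> quad a b c d \<subseteq> E"
  shows "(\<Sum>a\<in>E `` {v}. \<Sum>w\<in>E `` {a}. x w) \<le> real (card V) - 1"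
proof -
  let ?N = "E `` {v}"
  let ?U = "\<Union>a\<in>?N. E `` {a} - {v}"
  have s: "(q, p) \<in> E" if "(p, q) \<in> E" for p q using that assms by (auto dest: symD)
  have ir: "(p, p) \<notin> E" for p using assms by (auto simp: irrefl_def)
  have fin: "finite (E `` {a})" for a using assms by (auto intro: finite_subset[of _ V])
  have NV: "?N \<subseteq> V - {v}" using assms ir by auto
  have disj: "(E `` {a} - {v}) \<inter> (E `` {b} - {v}) = {}" if "a \<in> ?N" "b \<in> ?N" "a \<noteq> b" for a b
  proof (rule ccontr)
    assume "(E `` {a} - {v}) \<inter> (E `` {b} - {v}) \<noteq> {}"
    then obtain w where "w \<noteq> v" "(a, w) \<in> E" "(b, w) \<in> E" by auto
    with quad[of v a w b] that s ir show False by (auto simp: quad_def)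
  qed
  have U: "?U \<subseteq> V - {v} - ?N"
  proof
    fix w assume "w \<in> ?U"
    then obtain a where a: "(v, a) \<in> E" "(a, w) \<in> E" "w \<noteq> v" by auto
    then have "(v, w) \<notin> E" using tri[of v a w] s ir by (auto simp: tri_def)
    then show "w \<in> V - {v} - ?N" using a assms by auto
  qed
  \<comment> \<open>Walks that return to \<open>v\<close> contribute \<open>card ?N * x v\<close>,
    at most \<open>card ?N\<close>. All others end in distinct vertices outside \<open>v\<close> and
    \<open>?N\<close>, which contribute at most \<open>card V - 1 - card ?N\<close>.\<close>
  have "(\<Sum>a\<in>?N. \<Sum>w\<in>E `` {a}. x w) = (\<Sum>a\<in>?N. x v + (\<Sum>w\<in>E `` {a} - {v}. x w))"
    using fin s by (intro sum.cong refl sum.remove) auto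
  also have "\<dots> = card ?N * x v + (\<Sum>a\<in>?N. \<Sum>w\<in>E `` {a} - {v}. x w)"
    by (simp add: sum.distrib)
  also have "(\<Sum>a\<in>?N. \<Sum>w\<in>E `` {a} - {v}. x w) = (\<Sum>w\<in>?U. x w)"
    using fin disj by (intro sum.UNION_disjoint[symmetric]) auto
  also have "\<dots> \<le> (\<Sum>w\<in>?U. 1)" using U x by (intro sum_mono) auto
  also have "\<dots> = real (card ?U)" by simp
  also have "\<dots> \<le> real (card (V - {v} - ?N))"
    using U assms by (intro of_nat_mono card_mono) auto
  also have "card (V - {v} - ?N) = card V - 1 - card ?N"
    using NV assms fin by (simp add: card_Diff_subset)
  also have "real (card ?N) * x v \<le> real (card ?N) * 1"
    using x(2)[OF assms(5)] by (intro mult_left_mono) auto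
  also have "real (card V - 1 - card ?N) = real (card V) - 1 - real (card ?N)"
  proof -
    have "card ?N \<le> card V - 1" using card_mono[OF _ NV] assms by simp
    moreover have "1 \<le> card V" using assms by (auto simp: Suc_le_eq card_gt_0_iff)
    ultimately show ?thesis by linarith
  qed
  finally show ?thesis by simp
qed

lemma card_remove_edge:
  assumes "finite E" "sym E" "irrefl E" "(a, b) \<in> E"
  shows "card E = card (E - {(a, b), (b, a)}) + 2"
proof -
  have sub: "{(a, b), (b, a)} \<subseteq> E" using assms by (auto dest: symD)
  have "a \<noteq> b" using assms by (auto simp: irrefl_def)
  then have "card {(a, b), (b, a)} = 2" by simp
  with sub show ?thesis using assms
    by (metis card_Diff_subset card_mono finite.emptyI finite_insert le_add_diff_inverse2)
qed

text \<open>An edge bound of Erdos and Posa: since \<open>card E\<close> is even, there are at least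
  \<open>card V + 4\<close> edges (\<open>K_{3,3}\<close> shows that \<open>card V + 3\<close> do
  not suffice). Surplus edges, vertices of degree at most one and, by suppression, vertices of
  degree two lead to smaller instances. What remains has minimum degree three and so few vertices
  that it contains a cycle of length at most 4.\<close>

lemma packs_2_if_many_edges:
  assumes "finite V" "E \<subseteq> V \<times> V" "sym E" "irrefl E" "2 * card V + 7 \<le> card E"
  shows "packs 2 E"
  using assms
proof (induction "card V + card E" arbitrary: V E rule: less_induct)
  case less
  note [simp] = less.prems(1)
  have finE [simp]: "finite E" using less.prems by (auto intro: finite_subset)
  have s: "(q, p) \<in> E" if "(p, q) \<in> E" for p q using that less.prems by (auto dest: symD)
  have ir: "(p, p) \<notin> E" for p using less.prems by (auto simp: irrefl_def)
  have fin: "finite (E `` {a})" for a using less.prems by (auto intro: finite_subset[of _ V])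
  have "E \<noteq> {}" using less.prems(5) by auto
  then obtain p q where pq: "(p, q) \<in> E" by auto
  have V: "V \<noteq> {}" using pq less.prems by auto
  \<comment> \<open>Removing a cycle with at most 4 edges leaves
    \<open>card E - 8 >= 2 * card V - 1\<close>, just enough for a second cycle.\<close>
  have small: "packs 2 E" if "leafless F" "F \<subseteq> E" "card F \<le> 8" for F
    using packs_2_if_small_cycle[OF less.prems(1-4) V that(1,2)] that(3) less.prems(5) by simp
  consider "2 * card V + 9 \<le> card E" | "\<exists>v\<in>V. card (E `` {v}) \<le> 1" | "\<exists>v\<in>V. card (E `` {v}) = 2"
    | "card E < 2 * card V + 9" "\<forall>v\<in>V. card (E `` {v}) \<ge> 3"
    by force
  then show ?case
  proof cases
    case 1
    let ?E = "E - {(p, q), (q, p)}"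
    have "card E = card ?E + 2" using card_remove_edge[OF finE less.prems(3,4) pq] .
    then have "packs 2 ?E" using less.prems 1
      by (intro less.hyps[of V]) (auto simp: sym_def irrefl_def)
    then show ?thesis by (rule packs_mono) auto
  next
    case 2
    then obtain v where v: "v \<in> V" "card (E `` {v}) \<le> 1" by auto
    let ?E = "E \<inter> (V - {v}) \<times> (V - {v})"
    have c: "card E = card ?E + 2 * card (E `` {v})" using card_delete_vertex[OF less.prems(1-4)] .
    have cV: "card V = Suc (card (V - {v}))" using v by (metis card.remove less.prems(1))
    have "card (V - {v}) + card ?E < card V + card E" "2 * card (V - {v}) + 7 \<le> card ?E"
      using c cV v(2) less.prems(5) by linarith+
    then have "packs 2 ?E" using less.prems(3,4)
      by (intro less.hyps[of "V - {v}"]) (auto simp: sym_def irrefl_def)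
    then show ?thesis by (rule packs_mono) auto
  next
    case 3
    then obtain v where v: "v \<in> V" "card (E `` {v}) = 2" by auto
    then obtain a b where ab: "E `` {v} = {a, b}" "a \<noteq> b" by (auto simp: card_2_iff)
    then have va: "(v, a) \<in> E" and vb: "(v, b) \<in> E" by auto
    show ?thesis
    proof (cases "(a, b) \<in> E")
      case True
      show ?thesis
      proof (rule small)
        show "leafless (tri v a b)" using ir va vb ab by (intro leafless_tri) auto
        show "tri v a b \<subseteq> E" using va vb True s by (auto simp: tri_def)
        show "card (tri v a b) \<le> 8" using card_tri_le[of v a b] by simp
      qed
    next
      case False
      let ?E = "E \<inter> (V - {v}) \<times> (V - {v})"
      \<comment> \<open>Suppress \<open>v\<close>: replace the path \<open>a v b\<close> by the edge \<open>a b\<close>.\<close>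
      let ?E' = "insert (a, b) (insert (b, a) ?E)"
      have c: "card E = card ?E + 2 * card (E `` {v})" using card_delete_vertex[OF less.prems(1-4)] .
      have cV: "card V = Suc (card (V - {v}))" using v by (metis card.remove less.prems(1))
      have "(b, a) \<notin> E" using False s by blast
      then have c': "card ?E' = card ?E + 2" using False ab(2) by simp
      have abV: "a \<in> V - {v}" "b \<in> V - {v}" using va vb less.prems(2) ir by auto
      have num: "card (V - {v}) + card ?E' < card V + card E" "2 * card (V - {v}) + 7 \<le> card ?E'"
        using c c' cV v(2) less.prems(5) by linarith+
      have "packs 2 ?E'"
      proof (rule less.hyps[of "V - {v}"])
        show "sym ?E'" using less.prems(3) by (auto simp: sym_def)
        show "irrefl ?E'" using less.prems(4) ab(2) by (auto simp: irrefl_def)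
      qed (use abV num in auto)
      then obtain F1 F2 where F: "leafless F1" "leafless F2" "F1 \<subseteq> ?E'" "F2 \<subseteq> ?E' - F1"
        by (auto simp: numeral_2_eq_2)
      \<comment> \<open>\<open>L\<close> reroutes the edge \<open>a b\<close> through
        \<open>v\<close>. Of two disjoint sets only one can contain that edge, so the edges at
        \<open>v\<close> are used at most once.\<close>
      define L where "L = (\<lambda>F. if (a, b) \<in> F then F - {(a, b), (b, a)} \<union> {(a, v), (v, a), (b, v), (v, b)} else F)"
      have sF: "(q, p) \<in> F1 \<longleftrightarrow> (p, q) \<in> F1" "(q, p) \<in> F2 \<longleftrightarrow> (p, q) \<in> F2" for p q
        using F by (auto simp: leafless_def dest: symD)
      have "v \<notin> Field ?E'" using abV by (auto simp: Field_def)
      then have "v \<notin> Field F1" "v \<notin> Field F2" using F mono_Field[of F1 ?E'] mono_Field[of F2 ?E'] by blast+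
      then have "leafless (L F1)" "leafless (L F2)"
        using F leafless_subdivide[of F1 a b v] leafless_subdivide[of F2 a b v] by (auto simp: L_def)
      moreover have "L F1 \<subseteq> E" "L F2 \<subseteq> E"
        using F(3,4) va vb s sF(1)[of b a] sF(2)[of b a] unfolding L_def by (auto split: if_splits)
      moreover have "L F1 \<inter> L F2 = {}"
        using F(3,4) \<open>v \<notin> Field F1\<close> \<open>v \<notin> Field F2\<close> unfolding L_def by (auto simp: Field_def split: if_splits)
      ultimately show ?thesis by (rule packs_2I)
    qed
  next
    case 4
    \<comment> \<open>Minimum degree 3 leaves at most 8 vertices, too few for girth 5.\<close>
    have "3 * card V \<le> card E"
      using sum_mono[of V "\<lambda>_. 3" "\<lambda>v. card (E `` {v})"] 4 card_eq_sum_degrees[OF less.prems(1,2)] by simp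
    then have V8: "card V \<le> 8" using 4 by simp
    obtain v where v: "v \<in> V" using V by auto
    have "(\<Sum>w\<in>E `` {v}. 3) \<le> (\<Sum>a\<in>E `` {v}. real (card (E `` {a})))"
      using 4 less.prems(2) by (intro sum_mono) auto
    moreover have "3 \<le> card (E `` {v})" using 4 v by auto
    \<comment> \<open>At least three neighbours with at least three neighbours each give 9 walks of
      length two, whereas \<open>sum_walks2_le\<close> would allow at most
      \<open>card V - 1 <= 7\<close>.\<close>
    ultimately have ge: "9 \<le> (\<Sum>a\<in>E `` {v}. \<Sum>w\<in>E `` {a}. 1 :: real)" by simp
    show ?thesis
    proof (rule ccontr)
      assume neg: "\<not> packs 2 E"
      have "(\<Sum>a\<in>E `` {v}. \<Sum>w\<in>E `` {a}. 1 :: real) \<le> real (card V) - 1"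
      proof (rule sum_walks2_le)
        show "\<not> tri a b c \<subseteq> E" if "distinct [a, b, c]" for a b c
          using small[OF leafless_tri[OF that]] card_tri_le[of a b c] neg by auto
        show "\<not> quad a b c d \<subseteq> E" if "distinct [a, b, c, d]" for a b c d
          using small[OF leafless_quad[OF that]] card_quad_le[of a b c d] neg by auto
      qed (use less.prems v in auto)
      with ge V8 show False by simp
    qed
  qed
qed

section \<open>Cones without three edge-disjoint cycles\<close>

text \<open>In the cone over \<^term>\<open>S\<close> an edge, or a path of length two, of \<^term>\<open>S\<close> closes up to a triangle or a
  4-cycle through the apex. Packings in the cone thus correspond to edges, paths and cycles of \<^term>\<open>S\<close>
  that are edge-disjoint with all path ends distinct.\<close>

definition cone :: "'a \<Rightarrow> 'a set \<Rightarrow> ('a \<times> 'a) set \<Rightarrow> ('a \<times> 'a) set" where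
  "cone u N S = S \<union> {u} \<times> N \<union> N \<times> {u}"

lemma distinct_list_of_card:
  assumes "k \<le> card A"
  obtains xs where "length xs = k" "distinct xs" "set xs \<subseteq> A"
proof -
  obtain B where B: "B \<subseteq> A" "card B = k" "finite B"
    using obtain_subset_with_card_n[OF assms] by blast
  then obtain xs where "set xs = B" "distinct xs" using finite_distinct_list by blast
  then show thesis using that B distinct_card by metis
qed

locale cone_graph =
  fixes u :: 'a and N :: "'a set" and S :: "('a \<times> 'a) set"
  assumes finite_N: "finite N" and S_sub: "S \<subseteq> N \<times> N" and sym_S: "sym S" and irrefl_S: "irrefl S"
    and u_notin: "u \<notin> N"
begin

lemma S_D:
  assumes "(a, b) \<in> S"
  shows "(b, a) \<in> S" "a \<noteq> b" "b \<noteq> a" "a \<in> N" "b \<in> N" "a \<noteq> u" "b \<noteq> u" "u \<noteq> a" "u \<noteq> b"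
  using assms S_sub sym_S irrefl_S u_notin by (auto simp: irrefl_def dest: symD)

lemma finite_Image: "finite (S `` A)"
  using S_sub finite_N by (auto intro: finite_subset[of _ N])

lemma leafless_S_tri: "(a, b) \<in> S \<Longrightarrow> (b, c) \<in> S \<Longrightarrow> (a, c) \<in> S \<Longrightarrow> leafless (tri a b c)"
  using S_D by (intro leafless_tri) auto

lemma edge_tri:
  assumes "(a, b) \<in> S"
  shows "leafless (tri u a b)" "tri u a b \<subseteq> cone u N S"
proof -
  note D = S_D[OF assms]
  show "leafless (tri u a b)" using D by (intro leafless_tri) auto
  show "tri u a b \<subseteq> cone u N S" using D assms by (auto simp: tri_def cone_def)
qed

lemma cherry_quad:
  assumes "(a, c) \<in> S" "(c, b) \<in> S" "a \<noteq> b"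
  shows "leafless (quad u a c b)" "quad u a c b \<subseteq> cone u N S"
proof -
  note D = S_D[OF assms(1)] S_D[OF assms(2)]
  show "leafless (quad u a c b)" using D assms by (intro leafless_quad) auto
  show "quad u a c b \<subseteq> cone u N S" using D assms by (auto simp: quad_def cone_def)
qed

text \<open>The 4-cycle through the path \<open>p a q\<close> avoids the edge \<open>u a\<close>, so
  the remaining edge \<open>a r\<close> still closes up to a triangle.\<close>

lemma packs_2_degree_3:
  assumes "(a, p) \<in> S" "(a, q) \<in> S" "(a, r) \<in> S" "distinct [p, q, r]"
  shows "packs 2 (cone u N S)"
proof (rule packs_2I)
  note D = S_D[OF assms(1)] S_D[OF assms(2)] S_D[OF assms(3)]
  show "leafless (quad u p a q)" "quad u p a q \<subseteq> cone u N S"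
    using cherry_quad[of p a q] D assms by auto
  show "leafless (tri u a r)" "tri u a r \<subseteq> cone u N S" using edge_tri assms by auto
  show "quad u p a q \<inter> tri u a r = {}"
    using D assms(4) unfolding quad_def tri_def by auto
qed

lemma packs_2_matching:
  assumes "(a, b) \<in> S" "(c, d) \<in> S" "distinct [a, b, c, d]"
  shows "packs 2 (cone u N S)"
proof (rule packs_2I)
  note D = S_D[OF assms(1)] S_D[OF assms(2)]
  show "tri u a b \<inter> tri u c d = {}"
    using D assms(3) unfolding tri_def by auto
qed (use edge_tri assms in auto)

lemma degree_le_if_not_packs_2:
  assumes "\<not> packs 2 (cone u N S)"
  shows "card (S `` {v}) \<le> 2"
proof (rule ccontr)
  assume "\<not> ?thesis"
  then have "3 \<le> card (S `` {v})" by simp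
  then obtain xs where "length xs = 3" "distinct xs" "set xs \<subseteq> S `` {v}"
    by (rule distinct_list_of_card)
  then obtain p q r where "distinct [p, q, r]" "set [p, q, r] \<subseteq> S `` {v}"
    by (auto simp: numeral_eq_Suc length_Suc_conv)
  then show False using packs_2_degree_3[of v p q r] assms by auto
qed

text \<open>Every edge meets a fixed edge \<open>a b\<close>, since two disjoint edges give two
  triangles. If both \<open>a\<close> and \<open>b\<close> have a further neighbour, these coincide
  and \<open>S\<close> is a triangle, because degrees are at most two; otherwise all edges share one
  end and there are at most two of them.\<close>

lemma not_packs_2_cases:
  assumes "\<not> packs 2 (cone u N S)"
  obtains a b c where "distinct [a, b, c]" "S = tri a b c" | "card S \<le> 4"
proof (cases "S = {}")
  case True
  then show thesis using that by simp
next
  case False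
  then obtain a b where ab: "(a, b) \<in> S" by auto
  have meet: "x \<in> {a, b} \<or> y \<in> {a, b}" if "(x, y) \<in> S" for x y
    using packs_2_matching[OF ab that] assms S_D[OF ab] S_D[OF that] by auto
  have nb: "y = p \<or> y = q" if "(x, y) \<in> S" "(x, p) \<in> S" "(x, q) \<in> S" "p \<noteq> q" for x y p q
    using packs_2_degree_3[of x y p q] that assms by auto
  note D = S_D[OF ab]
  have star: thesis if "\<forall>d. (y, d) \<in> S \<longrightarrow> d = x" "{x, y} = {a, b}" for x y
  proof -
    have "p = x \<or> q = x" if "(p, q) \<in> S" for p q
      using meet[OF that] S_D(1)[OF that] that \<open>\<forall>d. (y, d) \<in> S \<longrightarrow> d = x\<close> \<open>{x, y} = {a, b}\<close> by blast
    then have "S \<subseteq> {x} \<times> S `` {x} \<union> S `` {x} \<times> {x}" using S_D(1) by fastforce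
    then have "card S \<le> card ({x} \<times> S `` {x} \<union> S `` {x} \<times> {x})"
      using finite_Image by (intro card_mono) auto
    also have "\<dots> \<le> card ({x} \<times> S `` {x}) + card (S `` {x} \<times> {x})" by (rule card_Un_le)
    also have "\<dots> \<le> 4" using degree_le_if_not_packs_2[OF assms, of x] by (simp add: card_cartesian_product)
    finally show thesis using \<open>card S \<le> 4 \<Longrightarrow> thesis\<close> by simp
  qed
  consider c d where "(a, c) \<in> S" "c \<noteq> b" "(b, d) \<in> S" "d \<noteq> a" | "\<forall>d. (b, d) \<in> S \<longrightarrow> d = a" | "\<forall>c. (a, c) \<in> S \<longrightarrow> c = b"
    by blast
  then show thesis
  proof cases
    case 1
    have "c = d" using packs_2_matching[OF 1(1) 1(3)] assms 1 D S_D[OF 1(1)] S_D[OF 1(3)] by auto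
    then have "S \<subseteq> tri a b c"
    proof -
      have "(x, y) \<in> tri a b c" if xy: "(x, y) \<in> S" for x y
      proof -
        note sy = S_D(1)[OF xy]
        have bc: "(b, c) \<in> S" using 1 \<open>c = d\<close> by simp
        have na: "z = b \<or> z = c" if "(a, z) \<in> S" for z using nb[OF that ab 1(1)] 1 by auto
        have nb': "z = a \<or> z = c" if "(b, z) \<in> S" for z using nb[OF that D(1) bc] 1 \<open>c = d\<close> by auto
        consider "x = a" | "x = b" | "y = a" | "y = b" using meet[OF xy] by blast
        then show ?thesis
          using na[of y] na[of x] nb'[of x] nb'[of y] xy sy by cases (auto simp: tri_def)
      qed
      then show ?thesis by auto
    qed
    moreover have "tri a b c \<subseteq> S" using 1 ab \<open>c = d\<close> S_D(1) by (auto simp: tri_def)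
    moreover have "distinct [a, b, c]" using 1 D S_D[OF 1(1)] by auto
    ultimately show thesis using that(1) by blast
  next
    case 2
    then show thesis by (intro star[of b a]) auto
  next
    case 3
    then show thesis by (intro star[of a b]) auto
  qed
qed

section \<open>Configurations that give three edge-disjoint cycles in a cone\<close>

lemma packs_3_matching:
  assumes "(a, a') \<in> S" "(b, b') \<in> S" "(c, c') \<in> S" "distinct [a, a', b, b', c, c']"
  shows "packs 3 (cone u N S)"
proof (rule packs_3I)
  note D = S_D[OF assms(1)] S_D[OF assms(2)] S_D[OF assms(3)]
  show "tri u a a' \<inter> tri u b b' = {}" "tri u a a' \<inter> tri u c c' = {}" "tri u b b' \<inter> tri u c c' = {}"
    using D assms(4) unfolding tri_def by auto
qed (use edge_tri assms in auto)

text \<open>Two paths of length two and one edge through \<open>c\<close> use each of the five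
  neighbours as an end once, and \<open>c\<close> itself only once.\<close>

lemma packs_3_degree_5:
  assumes "(c, p) \<in> S" "(c, q) \<in> S" "(c, r) \<in> S" "(c, s) \<in> S" "(c, t) \<in> S" "distinct [p, q, r, s, t]"
  shows "packs 3 (cone u N S)"
proof (rule packs_3I)
  note D = S_D[OF assms(1)] S_D[OF assms(2)] S_D[OF assms(3)] S_D[OF assms(4)] S_D[OF assms(5)]
  show "leafless (quad u p c q)" "quad u p c q \<subseteq> cone u N S"
    using cherry_quad[of p c q] D assms by auto
  show "leafless (quad u r c s)" "quad u r c s \<subseteq> cone u N S"
    using cherry_quad[of r c s] D assms by auto
  show "leafless (tri u c t)" "tri u c t \<subseteq> cone u N S"
    using edge_tri assms by auto
  show "quad u p c q \<inter> quad u r c s = {}" "quad u p c q \<inter> tri u c t = {}" "quad u r c s \<inter> tri u c t = {}"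
    using D assms(6) unfolding tri_def quad_def by auto
qed

lemma packs_3_star_edge:
  assumes "(c, q) \<in> S" "(c, r) \<in> S" "(c, s) \<in> S" "(p, x) \<in> S" "distinct [c, q, r, s, p, x]"
  shows "packs 3 (cone u N S)"
proof (rule packs_3I)
  note D = S_D[OF assms(1)] S_D[OF assms(2)] S_D[OF assms(3)] S_D[OF assms(4)]
  show "leafless (quad u q c r)" "quad u q c r \<subseteq> cone u N S"
    using cherry_quad[of q c r] D assms by auto
  show "leafless (tri u c s)" "tri u c s \<subseteq> cone u N S"
    using edge_tri assms by auto
  show "leafless (tri u p x)" "tri u p x \<subseteq> cone u N S"
    using edge_tri assms by auto
  show "quad u q c r \<inter> tri u c s = {}" "quad u q c r \<inter> tri u p x = {}" "tri u c s \<inter> tri u p x = {}"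
    using D assms(5) unfolding tri_def quad_def by auto
qed

text \<open>The triangle \<open>c q r\<close> lies inside \<open>S\<close>; the edges
  \<open>c s\<close> and \<open>p q\<close> supply the two cycles through the apex.\<close>

lemma packs_3_star_path:
  assumes "(c, q) \<in> S" "(c, r) \<in> S" "(c, s) \<in> S" "(p, q) \<in> S" "(q, r) \<in> S" "distinct [c, p, q, r, s]"
  shows "packs 3 (cone u N S)"
proof (rule packs_3I)
  note D = S_D[OF assms(1)] S_D[OF assms(2)] S_D[OF assms(3)] S_D[OF assms(4)] S_D[OF assms(5)]
  show "leafless (tri c q r)" "tri c q r \<subseteq> cone u N S"
    using leafless_S_tri assms D by (auto simp: cone_def tri_def)
  show "leafless (tri u c s)" "tri u c s \<subseteq> cone u N S"
    using edge_tri assms by auto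
  show "leafless (tri u p q)" "tri u p q \<subseteq> cone u N S"
    using edge_tri assms by auto
  show "tri c q r \<inter> tri u c s = {}" "tri c q r \<inter> tri u p q = {}" "tri u c s \<inter> tri u p q = {}"
    using D assms(6) unfolding tri_def by auto
qed

lemma degree_le_if_not_packs_3:
  assumes "\<not> packs 3 (cone u N S)"
  shows "card (S `` {v}) \<le> 4"
proof (rule ccontr)
  assume "\<not> ?thesis"
  then have "5 \<le> card (S `` {v})" by simp
  then obtain xs where "length xs = 5" "distinct xs" "set xs \<subseteq> S `` {v}"
    by (rule distinct_list_of_card)
  then obtain p q r s t where "distinct [p, q, r, s, t]" "set [p, q, r, s, t] \<subseteq> S `` {v}"
    by (auto simp: numeral_eq_Suc length_Suc_conv)
  then show False using packs_3_degree_5[of v p q r s t] assms by auto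
qed

text \<open>Partners for a matching are chosen greedily, each avoiding at most two vertices among
  three or more. That \<open>c\<close> is adjacent to neither \<open>a\<close> nor \<open>b\<close>
  excludes the remaining coincidences.\<close>

lemma packs_3_degree_3_isolated:
  assumes "distinct [a, b, c]" "(a, c) \<notin> S" "(b, c) \<notin> S"
    and "3 \<le> card (S `` {a})" "3 \<le> card (S `` {b})" "3 \<le> card (S `` {c})"
  shows "packs 3 (cone u N S)"
proof -
  have "\<not> S `` {a} \<subseteq> {b}"
    using assms(4) card_mono[of "{b}" "S `` {a}"] by auto
  then obtain a' where a': "(a, a') \<in> S" "a' \<noteq> b" by auto
  have "\<not> S `` {b} \<subseteq> {a, a'}"
    using assms(5) card_mono[of "{a, a'}" "S `` {b}"] card_length[of "[a, a']"] by auto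
  then obtain b' where b': "(b, b') \<in> S" "b' \<noteq> a" "b' \<noteq> a'" by auto
  have "\<not> S `` {c} \<subseteq> {a', b'}"
    using assms(6) card_mono[of "{a', b'}" "S `` {c}"] card_length[of "[a', b']"] by auto
  then obtain c' where c': "(c, c') \<in> S" "c' \<noteq> a'" "c' \<noteq> b'" by auto
  have "c' \<noteq> a" "c' \<noteq> b" "a' \<noteq> c" "b' \<noteq> c" using assms a' b' c' S_D(1) by auto
  then show ?thesis
    using packs_3_matching[of a a' b b' c c'] assms(1) a' b' c' S_D(2) by auto
qed

text \<open>Let \<open>b'\<close> be a third neighbour of \<open>b\<close>. If \<open>a\<close> is
  not adjacent to \<open>b'\<close>, then \<open>a\<close> has two possible partners, one of which
  differs from that of \<open>c\<close>, and a matching exists. Otherwise the triangle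
  \<open>a b b'\<close> is taken inside \<open>S\<close>, and the edges \<open>a z\<close> and
  \<open>b c\<close> are closed through the apex.\<close>

lemma packs_3_degree_3_path:
  assumes "distinct [a, b, c]" "(a, b) \<in> S" "(b, c) \<in> S" "(a, c) \<notin> S"
    and "3 \<le> card (S `` {a})" "3 \<le> card (S `` {b})" "3 \<le> card (S `` {c})"
  shows "packs 3 (cone u N S)"
proof -
  have two: "\<not> S `` {v} \<subseteq> {x, y}" if "3 \<le> card (S `` {v})" for v x y
    using that card_mono[of "{x, y}" "S `` {v}"] card_length[of "[x, y]"] by auto
  obtain b' where b': "(b, b') \<in> S" "b' \<noteq> a" "b' \<noteq> c" using two[OF assms(6), of a c] by auto
  obtain z where z: "(a, z) \<in> S" "z \<noteq> b" "z \<noteq> b'" using two[OF assms(5), of b b'] by auto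
  have zc: "z \<noteq> c" using z assms(4) by auto
  show ?thesis
  proof (cases "(a, b') \<in> S")
    case False
    obtain z' where z': "(a, z') \<in> S" "z' \<noteq> b" "z' \<noteq> z" using two[OF assms(5), of b z] by auto
    obtain c' where c': "(c, c') \<in> S" "c' \<noteq> b" "c' \<noteq> b'" using two[OF assms(7), of b b'] by auto
    have "z' \<noteq> c" "z' \<noteq> b'" "c' \<noteq> a" using z' c' assms(4) False S_D(1) by auto
    then show ?thesis
      using packs_3_matching[of a z b b' c c'] packs_3_matching[of a z' b b' c c'] assms(1) b' c' z z' zc S_D(2)
      by (cases "c' = z") auto
  next
    case True
    note D = S_D[OF assms(2)] S_D[OF assms(3)] S_D[OF b'(1)] S_D[OF z(1)] S_D[OF True]
    show ?thesis
    proof (rule packs_3I)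
      show "leafless (tri a b b')" "tri a b b' \<subseteq> cone u N S"
        using leafless_S_tri assms D b' True by (auto simp: cone_def tri_def)
      show "leafless (tri u a z)" "tri u a z \<subseteq> cone u N S"
        using edge_tri z by auto
      show "leafless (tri u b c)" "tri u b c \<subseteq> cone u N S"
        using edge_tri assms by auto
      show "tri a b b' \<inter> tri u a z = {}" "tri a b b' \<inter> tri u b c = {}" "tri u a z \<inter> tri u b c = {}"
        using D assms(1) z b' zc unfolding tri_def by auto
    qed
  qed
qed

text \<open>The triangle \<open>a b z\<close> lies in \<open>S\<close>; the path
  \<open>a c b\<close> and the edge \<open>c w\<close> have four distinct ends, and \<open>c\<close>
  is only an inner vertex of the path.\<close>

lemma packs_3_triangle_pendant:
  assumes "distinct [a, b, c, z, w]" "(a, b) \<in> S" "(b, c) \<in> S" "(a, c) \<in> S" "(a, z) \<in> S" "(b, z) \<in> S" "(c, w) \<in> S"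
  shows "packs 3 (cone u N S)"
proof (rule packs_3I)
  note D = S_D[OF assms(2)] S_D[OF assms(3)] S_D[OF assms(4)] S_D[OF assms(5)] S_D[OF assms(6)] S_D[OF assms(7)]
  show "leafless (tri a b z)" "tri a b z \<subseteq> cone u N S"
    using leafless_S_tri assms D by (auto simp: cone_def tri_def)
  show "leafless (tri u c w)" "tri u c w \<subseteq> cone u N S"
    using edge_tri assms by auto
  show "leafless (quad u a c b)" "quad u a c b \<subseteq> cone u N S"
    using cherry_quad[of a c b] D assms by auto
  show "tri a b z \<inter> tri u c w = {}" "tri a b z \<inter> quad u a c b = {}" "tri u c w \<inter> quad u a c b = {}"
    using D assms(1) unfolding tri_def quad_def by auto
qed

text \<open>A Hamiltonian 4-cycle is taken inside \<open>S\<close>, and the two diagonals are closed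
  through the apex.\<close>

lemma packs_3_K4:
  assumes "distinct [a, b, c, z]" "(a, b) \<in> S" "(b, c) \<in> S" "(a, c) \<in> S" "(a, z) \<in> S" "(b, z) \<in> S" "(c, z) \<in> S"
  shows "packs 3 (cone u N S)"
proof (rule packs_3I)
  note D = S_D[OF assms(2)] S_D[OF assms(3)] S_D[OF assms(4)] S_D[OF assms(5)] S_D[OF assms(6)] S_D[OF assms(7)]
  show "leafless (quad a b c z)" using assms by (intro leafless_quad) auto
  show "quad a b c z \<subseteq> cone u N S" using assms D by (auto simp: cone_def quad_def)
  show "leafless (tri u a c)" "tri u a c \<subseteq> cone u N S"
    using edge_tri assms by auto
  show "leafless (tri u b z)" "tri u b z \<subseteq> cone u N S"
    using edge_tri assms by auto
  show "quad a b c z \<inter> tri u a c = {}" "quad a b c z \<inter> tri u b z = {}" "tri u a c \<inter> tri u b z = {}"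
    using D assms(1) unfolding tri_def quad_def by auto
qed

text \<open>Each corner has a neighbour off the triangle. Three distinct ones give a matching, a
  common one gives \<open>K_4\<close>, and exactly two equal ones give a second triangle on a side
  together with a pendant edge.\<close>

lemma packs_3_degree_3_triangle:
  assumes "distinct [a, b, c]" "(a, b) \<in> S" "(b, c) \<in> S" "(a, c) \<in> S"
    and "3 \<le> card (S `` {a})" "3 \<le> card (S `` {b})" "3 \<le> card (S `` {c})"
  shows "packs 3 (cone u N S)"
proof -
  have two: "\<not> S `` {v} \<subseteq> {x, y}" if "3 \<le> card (S `` {v})" for v x y
    using that card_mono[of "{x, y}" "S `` {v}"] card_length[of "[x, y]"] by auto
  obtain a' where a': "(a, a') \<in> S" "a' \<noteq> b" "a' \<noteq> c" using two[OF assms(5), of b c] by auto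
  obtain b' where b': "(b, b') \<in> S" "b' \<noteq> a" "b' \<noteq> c" using two[OF assms(6), of a c] by auto
  obtain c' where c': "(c, c') \<in> S" "c' \<noteq> a" "c' \<noteq> b" using two[OF assms(7), of a b] by auto
  note s = S_D(1)[OF assms(2)] S_D(1)[OF assms(3)] S_D(1)[OF assms(4)]
  note n = S_D(2)[OF a'(1)] S_D(2)[OF b'(1)] S_D(2)[OF c'(1)]
  consider "a' \<noteq> b'" "b' \<noteq> c'" "a' \<noteq> c'" | "a' = b'" "b' = c'" | "a' = b'" "b' \<noteq> c'"
    | "a' = c'" "b' \<noteq> c'" | "b' = c'" "a' \<noteq> c'" by blast
  then show ?thesis
  proof cases
    case 1
    then show ?thesis using packs_3_matching[of a a' b b' c c'] assms(1) a' b' c' n by auto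
  next
    case 2
    then show ?thesis using packs_3_K4[of a b c c'] assms(1-4) a' b' c' n by auto
  next
    case 3
    then show ?thesis using packs_3_triangle_pendant[of a b c b' c'] assms(1-4) a' b' c' n by auto
  next
    case 4
    then show ?thesis using packs_3_triangle_pendant[of a c b c' b'] assms(1-4) a' b' c' n s by auto
  next
    case 5
    then show ?thesis using packs_3_triangle_pendant[of b c a c' a'] assms(1-4) a' b' c' n s by auto
  qed
qed

lemma packs_3_degree_3:
  assumes "distinct [a, b, c]"
    and "3 \<le> card (S `` {a})" "3 \<le> card (S `` {b})" "3 \<le> card (S `` {c})"
  shows "packs 3 (cone u N S)"
proof -
  have s: "(x, y) \<in> S \<longleftrightarrow> (y, x) \<in> S" for x y using S_D(1) by blast
  have d: "distinct [b, c, a]" "distinct [a, c, b]" "distinct [b, a, c]" using assms(1) by auto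
  consider "(a, c) \<notin> S" "(b, c) \<notin> S" | "(b, a) \<notin> S" "(c, a) \<notin> S" | "(a, b) \<notin> S" "(c, b) \<notin> S"
    | "(a, b) \<in> S" "(b, c) \<in> S" "(a, c) \<notin> S" | "(a, c) \<in> S" "(c, b) \<in> S" "(a, b) \<notin> S"
    | "(b, a) \<in> S" "(a, c) \<in> S" "(b, c) \<notin> S" | "(a, b) \<in> S" "(b, c) \<in> S" "(a, c) \<in> S"
    using s by metis
  then show ?thesis
    using packs_3_degree_3_isolated[OF assms(1) _ _ assms(2,3,4)]
      packs_3_degree_3_isolated[OF d(1) _ _ assms(3,4,2)]
      packs_3_degree_3_isolated[OF d(2) _ _ assms(2,4,3)]
      packs_3_degree_3_path[OF assms(1) _ _ _ assms(2,3,4)]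
      packs_3_degree_3_path[OF d(2) _ _ _ assms(2,4,3)]
      packs_3_degree_3_path[OF d(3) _ _ _ assms(3,2,4)]
      packs_3_degree_3_triangle[OF assms(1) _ _ _ assms(2,3,4)]
    by cases
qed

text \<open>An edge avoiding \<open>c\<close> must join two neighbours of \<open>c\<close>, or three
  neighbours would remain for \<open>packs_3_star_edge\<close>; two such edges cannot meet, by
  \<open>packs_3_star_path\<close>. So these edges form a matching on four vertices: two of them
  give \<open>F_2\<close>, and otherwise there are at most five edges in all.\<close>

lemma not_packs_3_degree_4_cases:
  assumes np: "\<not> packs 3 (cone u N S)" and c: "card (S `` {c}) = 4"
  obtains p q r s where "distinct [c, p, q, r, s]" "S = tri c p q \<union> tri c r s" | "card S \<le> 10"
proof -
  let ?P = "S `` {c}"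
  have finP: "finite ?P" by (rule finite_Image)
  have cP: "c \<notin> ?P" using S_D(2) by auto
  have both: "x \<in> ?P \<and> y \<in> ?P" if xy: "(x, y) \<in> S" "x \<noteq> c" "y \<noteq> c" for x y
  proof (rule ccontr)
    assume neg: "\<not> (x \<in> ?P \<and> y \<in> ?P)"
    have "card (?P - {x, y}) \<ge> 3"
    proof (cases "x \<in> ?P")
      case True
      then have "?P - {x, y} = ?P - {x}" using neg by auto
      then show ?thesis using True c finP by (simp add: card_Diff_singleton)
    next
      case False
      then have "?P - {x, y} = ?P - {y}" by auto
      then show ?thesis using c finP by (simp add: card_Diff_singleton_if)
    qed
    then obtain xs where "length xs = 3" "distinct xs" "set xs \<subseteq> ?P - {x, y}"
      by (rule distinct_list_of_card)
    then obtain q r s where "distinct [q, r, s]" "set [q, r, s] \<subseteq> ?P - {x, y}"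
      by (auto simp: numeral_eq_Suc length_Suc_conv)
    then show False
      using packs_3_star_edge[of c q r s x y] np xy S_D(2)[OF xy(1)] cP by auto
  qed
  have unique: "y = z" if "(x, y) \<in> S" "(x, z) \<in> S" "x \<noteq> c" "y \<noteq> c" "z \<noteq> c" for x y z
  proof (rule ccontr)
    assume "y \<noteq> z"
    have "\<not> ?P \<subseteq> {x, y, z}"
      using card_mono[of "{x, y, z}" ?P] card_length[of "[x, y, z]"] c by auto
    then obtain w where w: "w \<in> ?P" "w \<notin> {x, y, z}" by auto
    have "packs 3 (cone u N S)"
      using both[OF that(1,3,4)] both[OF that(2,3,5)] that S_D(1)[OF that(1)] S_D(2)[OF that(1)] S_D(2)[OF that(2)] w \<open>y \<noteq> z\<close> cP
      by (intro packs_3_star_path[of c x z w y]) auto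
    with np show False by simp
  qed
  have star: "(x, y) \<in> {c} \<times> ?P \<union> ?P \<times> {c}" if "(x, y) \<in> S" "x = c \<or> y = c" for x y
    using that S_D(1) by auto
  have cs: "card ({c} \<times> ?P \<union> ?P \<times> {c}) \<le> 8"
    using card_Un_le[of "{c} \<times> ?P" "?P \<times> {c}"] c by (simp add: card_cartesian_product)
  show thesis
  proof (cases "\<exists>x y. (x, y) \<in> S \<and> x \<noteq> c \<and> y \<noteq> c")
    case False
    then have "S \<subseteq> {c} \<times> ?P \<union> ?P \<times> {c}" using star by auto
    then have "card S \<le> card ({c} \<times> ?P \<union> ?P \<times> {c})" using finP by (intro card_mono) auto
    then show thesis using cs that by simp
  next
    case True
    then obtain p q where pq: "(p, q) \<in> S" "p \<noteq> c" "q \<noteq> c" by auto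
    have pqP: "p \<in> ?P" "q \<in> ?P" using both[OF pq] by auto
    note qp = S_D(1,2)[OF pq(1)]
    have "card (?P - {p, q}) = 2" using c pqP qp(2) finP by (simp add: card_Diff_subset)
    then obtain r s where rs: "?P - {p, q} = {r, s}" "r \<noteq> s" by (auto simp: card_2_iff)
    then have P: "?P = {p, q, r, s}" and rsd: "r \<notin> {p, q}" "s \<notin> {p, q}" using pqP by auto
    have rest: "(x, y) \<in> {(p, q), (q, p)} \<or> (x \<in> {r, s} \<and> y \<in> {r, s} \<and> x \<noteq> y)" if xy: "(x, y) \<in> S" "x \<noteq> c" "y \<noteq> c" for x y
    proof -
      have "x \<in> ?P" "y \<in> ?P" "x \<noteq> y" using both[OF xy] S_D(2)[OF xy(1)] by auto
      moreover have "x = p \<Longrightarrow> y = q" "x = q \<Longrightarrow> y = p" using unique[of x y] xy pq qp by blast+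
      moreover have "y = p \<Longrightarrow> x = q" "y = q \<Longrightarrow> x = p" using unique[of y x] S_D(1)[OF xy(1)] xy pq qp by blast+
      ultimately show ?thesis unfolding P by blast
    qed
    show thesis
    proof (cases "(r, s) \<in> S")
      case True
      have d: "distinct [c, p, q, r, s]" using pq qp rs(2) rsd cP P by auto
      have "S = tri c p q \<union> tri c r s"
      proof
        show "tri c p q \<union> tri c r s \<subseteq> S"
        proof -
          have "(c, p) \<in> S" "(c, q) \<in> S" "(c, r) \<in> S" "(c, s) \<in> S" using P by blast+
          then show ?thesis using pq True S_D(1) by (auto simp: tri_def)
        qed
        show "S \<subseteq> tri c p q \<union> tri c r s"
        proof
          fix e assume "e \<in> S"
          then obtain x y where e: "e = (x, y)" "(x, y) \<in> S" by (cases e) auto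
          show "e \<in> tri c p q \<union> tri c r s"
          proof (cases "x = c \<or> y = c")
            case True
            then show ?thesis using star[OF e(2) True] e(1) unfolding P tri_def by blast
          next
            case False
            then show ?thesis using rest[OF e(2)] e(1) unfolding tri_def by blast
          qed
        qed
      qed
      with d show thesis using that(1) by blast
    next
      case False
      have sr: "(s, r) \<notin> S" using False S_D(1) by blast
      have "S \<subseteq> {(p, q), (q, p)} \<union> ({c} \<times> ?P \<union> ?P \<times> {c})"
      proof
        fix e assume "e \<in> S"
        then obtain x y where e: "e = (x, y)" "(x, y) \<in> S" by (cases e) auto
        show "e \<in> {(p, q), (q, p)} \<union> ({c} \<times> ?P \<union> ?P \<times> {c})"
        proof (cases "x = c \<or> y = c")
          case True
          then show ?thesis using star[OF e(2) True] e(1) by blast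
        next
          case 2: False
          have "(x, y) \<noteq> (r, s)" "(x, y) \<noteq> (s, r)" using e(2) False sr by auto
          then show ?thesis using rest[OF e(2)] 2 e(1) by blast
        qed
      qed
      then have "card S \<le> card ({(p, q), (q, p)} \<union> ({c} \<times> ?P \<union> ?P \<times> {c}))"
        using finP by (intro card_mono) auto
      also have "\<dots> \<le> card {(p, q), (q, p)} + card ({c} \<times> ?P \<union> ?P \<times> {c})" by (rule card_Un_le)
      also have "\<dots> \<le> 10" using cs card_length[of "[(p, q), (q, p)]"] by simp
      finally show thesis using that by simp
    qed
  qed
qed

text \<open>By \<open>packs_3_degree_3\<close> at most two vertices have degree three. If every edge
  meets one of them, there are at most six edges. Otherwise an edge \<open>a b\<close> avoids both:
  deleting \<open>a\<close> and \<open>b\<close> removes at most three edges, and the rest has at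
  most three because its cone cannot pack two cycles besides the triangle
  \<open>u a b\<close>.\<close>

lemma not_packs_3_degree_3_bounds:
  assumes np: "\<not> packs 3 (cone u N S)" and le3: "\<And>v. card (S `` {v}) \<le> 3"
  shows "card S \<le> 12" "(\<Sum>v\<in>N. (card (S `` {v}))\<^sup>2) \<le> 30"
proof -
  define T where "T = {v \<in> N. card (S `` {v}) = 3}"
  have finT: "finite T" using finite_N by (simp add: T_def)
  have T2: "card T \<le> 2"
  proof (rule ccontr)
    assume "\<not> card T \<le> 2"
    then have "3 \<le> card T" by simp
    then obtain xs where "length xs = 3" "distinct xs" "set xs \<subseteq> T"
      by (rule distinct_list_of_card)
    then obtain a b c where "distinct [a, b, c]" "set [a, b, c] \<subseteq> T"
      by (auto simp: numeral_eq_Suc length_Suc_conv)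
    then show False using packs_3_degree_3[of a b c] np by (auto simp: T_def)
  qed
  show S12: "card S \<le> 12"
  proof (cases "\<exists>a b. (a, b) \<in> S \<and> a \<notin> T \<and> b \<notin> T")
    case True
    then obtain a b where ab: "(a, b) \<in> S" "a \<notin> T" "b \<notin> T" by auto
    note D = S_D[OF ab(1)]
    let ?N1 = "N - {a}" let ?S1 = "S \<inter> ?N1 \<times> ?N1"
    let ?N2 = "N - {a} - {b}" let ?S2 = "?S1 \<inter> (N - {b}) \<times> (N - {b})"
    have da: "card (S `` {a}) \<le> 2" "card (S `` {b}) \<le> 2"
      using ab le3[of a] le3[of b] D by (auto simp: T_def)
    have "card S = card ?S1 + 2 * card (S `` {a})"
      using card_delete_vertex[OF finite_N S_sub sym_S irrefl_S] .
    moreover have "card ?S1 = card ?S2 + 2 * card (?S1 `` {b})"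
      using sym_S irrefl_S by (intro card_delete_vertex[OF finite_N]) (auto simp: sym_def irrefl_def)
    moreover have "card (?S1 `` {b}) \<le> 1"
    proof -
      have "?S1 `` {b} \<subseteq> S `` {b} - {a}" by auto
      then have "card (?S1 `` {b}) \<le> card (S `` {b} - {a})" using finite_Image by (intro card_mono) auto
      also have "\<dots> = card (S `` {b}) - 1" using D(1) by (simp add: card_Diff_singleton)
      finally show ?thesis using da by simp
    qed
    moreover have "card ?S2 \<le> 6"
    proof -
      interpret R: cone_graph u ?N2 ?S2
        using finite_N sym_S irrefl_S u_notin by unfold_locales (auto simp: sym_def irrefl_def)
      have "\<not> packs 2 (cone u ?N2 ?S2)"
      proof
        assume "packs 2 (cone u ?N2 ?S2)"
        moreover have "cone u ?N2 ?S2 \<subseteq> cone u N S - tri u a b"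
          using D by (auto simp: cone_def tri_def)
        ultimately have "packs (Suc 2) (cone u N S)"
          using packs_SucI[OF edge_tri[OF ab(1)]] by blast
        then show False using np by (simp add: numeral_3_eq_3 numeral_2_eq_2)
      qed
      then show ?thesis
        by (rule R.not_packs_2_cases) (use card_tri_le in auto)
    qed
    ultimately show ?thesis using da by linarith
  next
    case False
    have "S \<subseteq> (\<Union>t\<in>T. {t} \<times> S `` {t} \<union> S `` {t} \<times> {t})"
    proof
      fix e assume "e \<in> S"
      then obtain x y where e: "e = (x, y)" "(x, y) \<in> S" by (cases e) auto
      with False S_D(1)[OF e(2)] show "e \<in> (\<Union>t\<in>T. {t} \<times> S `` {t} \<union> S `` {t} \<times> {t})" by blast
    qed
    then have "card S \<le> card (\<Union>t\<in>T. {t} \<times> S `` {t} \<union> S `` {t} \<times> {t})"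
      using finT finite_Image by (intro card_mono) auto
    also have "\<dots> \<le> (\<Sum>t\<in>T. card ({t} \<times> S `` {t} \<union> S `` {t} \<times> {t}))" by (rule card_UN_le[OF finT])
    also have "\<dots> \<le> (\<Sum>t\<in>T. 6)"
    proof (rule sum_mono)
      fix t assume "t \<in> T"
      have "card ({t} \<times> S `` {t} \<union> S `` {t} \<times> {t}) \<le> card ({t} \<times> S `` {t}) + card (S `` {t} \<times> {t})"
        by (rule card_Un_le)
      also have "\<dots> \<le> 6" using le3[of t] by (simp add: card_cartesian_product)
      finally show "card ({t} \<times> S `` {t} \<union> S `` {t} \<times> {t}) \<le> 6" .
    qed
    also have "\<dots> \<le> 12" using T2 by simp
    finally show ?thesis .
  qed
  have "(\<Sum>v\<in>N. (card (S `` {v}))\<^sup>2) \<le> (\<Sum>v\<in>N. 2 * card (S `` {v}) + (if v \<in> T then 3 else 0))"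
  proof (rule sum_mono)
    \<comment> \<open>For \<open>d <= 2\<close> one has \<open>d^2 <= 2 * d\<close>, and a vertex of
      degree three exceeds this by 3; the total is at most
      \<open>2 * 12 + 3 * 2 = 30\<close>.\<close>
    fix v assume v: "v \<in> N"
    have "card (S `` {v}) \<in> {0, 1, 2, 3}" using le3[of v] by auto
    then show "(card (S `` {v}))\<^sup>2 \<le> 2 * card (S `` {v}) + (if v \<in> T then 3 else 0)"
      using v unfolding T_def by (elim insertE emptyE) simp_all
  qed
  also have "\<dots> = 2 * card S + 3 * card T"
  proof -
    have "T \<subseteq> N" by (auto simp: T_def)
    then have "N \<inter> T = T" by auto
    then show ?thesis
      using card_eq_sum_degrees[OF finite_N S_sub] finite_N
      by (simp add: sum.distrib sum_distrib_left[symmetric] sum.If_cases)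
  qed
  also have "\<dots> \<le> 30" using S12 T2 by simp
  finally show "(\<Sum>v\<in>N. (card (S `` {v}))\<^sup>2) \<le> 30" .
qed

end

section \<open>Walks of length two from a vertex of maximum weight\<close>

text \<open>\<^term>\<open>x\<close> is the vector of moduli of an eigenvector, scaled to have its maximum 1 at \<^term>\<open>u\<close>;
  only the inequality survives taking moduli, and it is enough.\<close>

locale top_vertex =
  fixes n :: nat and G :: "nat \<Rightarrow> nat \<Rightarrow> bool" and lam :: real and x :: "nat \<Rightarrow> real" and u :: nat
  assumes G: "simple_graph n G" and u: "u < n" and x_u: "x u = 1"
    and x_nonneg: "\<And>v. v < n \<Longrightarrow> 0 \<le> x v" and x_le_1: "\<And>v. v < n \<Longrightarrow> x v \<le> 1"
    and sub: "\<And>v. v < n \<Longrightarrow> lam * x v \<le> (\<Sum>w\<in>nbs G v. x w)"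
    and lam_pos: "lam > 0"
begin

definition "N = nbs G u"
definition "W = {..<n} - insert u N"
text \<open>This is the number of walks of length two from \<open>u\<close> to
  \<open>v\<close>.\<close>

definition "dN v = card (nbs G v \<inter> N)"
definition "dW v = card (nbs G v \<inter> W)"

lemma nbs_sym: "a \<in> nbs G b \<longleftrightarrow> b \<in> nbs G a"
  using G by (auto simp: nbs_def simple_graph_def)

lemma finite_nbs_G [simp]: "finite (nbs G v)"
  using finite_nbs[OF G] .

lemma finite_NW [simp]: "finite N" "finite W"
  by (simp_all add: N_def W_def)

lemma nbs_less: "w \<in> nbs G v \<Longrightarrow> w < n" "w \<in> nbs G v \<Longrightarrow> v < n" "v \<notin> nbs G v"
  using G by (auto simp: nbs_def simple_graph_def)

lemma N_less: "v \<in> N \<Longrightarrow> v < n" "u \<notin> N"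
  using nbs_less by (auto simp: N_def)

lemma W_less: "v \<in> W \<Longrightarrow> v < n" "u \<notin> W"
  by (auto simp: W_def)

lemma sum_vertices: "(\<Sum>v<n. f v) = f u + (\<Sum>v\<in>N. f v) + (\<Sum>v\<in>W. f v)" for f :: "nat \<Rightarrow> 'b::comm_monoid_add"
proof -
  have "N \<subseteq> {..<n}" using N_less(1) by blast
  then have "{..<n} = insert u (N \<union> W)" using u unfolding W_def by blast
  moreover have "(\<Sum>v\<in>N \<union> W. f v) = (\<Sum>v\<in>N. f v) + (\<Sum>v\<in>W. f v)"
    using W_def by (intro sum.union_disjoint) auto
  ultimately show ?thesis using N_less(2) W_less(2) by (simp add: add.assoc)
qed

lemma order_eq: "n = 1 + card N + card W"
  using sum_vertices[of "\<lambda>_. 1 :: nat"] by simp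

lemma sum_nbs_split:
  fixes f :: "nat \<Rightarrow> 'b::comm_monoid_add"
  assumes "v < n"
  shows "(\<Sum>w\<in>nbs G v. f w) = (if v \<in> N then f u else 0) + (\<Sum>w\<in>nbs G v \<inter> N. f w) + (\<Sum>w\<in>nbs G v \<inter> W. f w)"
proof -
  have "(\<Sum>w\<in>nbs G v. f w) = (\<Sum>w<n. if w \<in> nbs G v then f w else 0)"
    using nbs_less by (simp add: sum.If_cases) (intro sum.cong, auto)
  also have "\<dots> = (if u \<in> nbs G v then f u else 0) + (\<Sum>w\<in>N. if w \<in> nbs G v then f w else 0)
      + (\<Sum>w\<in>W. if w \<in> nbs G v then f w else 0)"
    by (rule sum_vertices)
  finally show ?thesis using nbs_sym[of u v]
    by (simp add: sum.inter_restrict N_def[symmetric] Int_commute[of "nbs G v"])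
qed

lemma sum_nbs_swap:
  fixes f :: "nat \<Rightarrow> 'b::semiring_1"
  assumes "finite A" "finite B"
  shows "(\<Sum>a\<in>A. \<Sum>w\<in>nbs G a \<inter> B. f w) = (\<Sum>w\<in>B. of_nat (card (nbs G w \<inter> A)) * f w)"
proof -
  have "(\<Sum>a\<in>A. \<Sum>w\<in>nbs G a \<inter> B. f w) = (\<Sum>a\<in>A. \<Sum>w\<in>B. if w \<in> nbs G a then f w else 0)"
    using assms by (simp add: sum.inter_restrict Int_commute[of "nbs G _"])
  also have "\<dots> = (\<Sum>w\<in>B. \<Sum>a\<in>A. if a \<in> nbs G w then f w else 0)"
    by (subst sum.swap) (simp add: nbs_sym)
  also have "\<dots> = (\<Sum>w\<in>B. \<Sum>a\<in>A \<inter> nbs G w. f w)"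
    by (simp only: sum.inter_restrict[OF assms(1)])
  finally show ?thesis by (simp add: Int_commute[of A])
qed

lemma lam_sq_le_walks: "lam\<^sup>2 \<le> (\<Sum>a\<in>N. \<Sum>w\<in>nbs G a. x w)"
proof -
  have "lam\<^sup>2 = lam * (lam * x u)" by (simp add: x_u power2_eq_square)
  also have "\<dots> \<le> lam * (\<Sum>a\<in>N. x a)" using sub[OF u] lam_pos by (simp add: N_def)
  also have "\<dots> = (\<Sum>a\<in>N. lam * x a)" by (rule sum_distrib_left)
  also have "\<dots> \<le> (\<Sum>a\<in>N. \<Sum>w\<in>nbs G a. x w)" using sub N_less by (intro sum_mono) auto
  finally show ?thesis .
qed

text \<open>The walks of length two from \<open>u\<close> are grouped by their end; those returning
  to \<open>u\<close> give \<open>card N\<close>, as \<open>x u = 1\<close>.\<close>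

lemma lam_sq_le: "lam\<^sup>2 \<le> card N + (\<Sum>v\<in>N. dN v * x v) + (\<Sum>v\<in>W. dN v * x v)"
proof -
  have "(\<Sum>a\<in>N. \<Sum>w\<in>nbs G a. x w) = (\<Sum>a\<in>N. \<Sum>w\<in>nbs G a \<inter> {..<n}. x w)"
    using nbs_less by (intro sum.cong refl) auto
  also have "\<dots> = (\<Sum>w<n. dN w * x w)" unfolding dN_def by (rule sum_nbs_swap) auto
  also have "\<dots> = card N + (\<Sum>v\<in>N. dN v * x v) + (\<Sum>v\<in>W. dN v * x v)"
    by (simp add: sum_vertices x_u) (simp add: dN_def N_def)
  finally show ?thesis using lam_sq_le_walks by simp
qed

lemma sum_degrees: "(\<Sum>v<n. card (nbs G v)) = 2 * card N + (\<Sum>v\<in>N. dN v) + 2 * (\<Sum>v\<in>W. dN v) + (\<Sum>v\<in>W. dW v)"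
proof -
  have deg: "card (nbs G v) = (if v \<in> N then 1 else 0) + dN v + dW v" if "v < n" for v
    using sum_nbs_split[OF that, of "\<lambda>_. 1 :: nat"] by (simp add: dN_def dW_def)
  then have "card (nbs G v) = 1 + dN v + dW v" if "v \<in> N" for v using N_less(1)[OF that] that by simp
  then have "(\<Sum>v\<in>N. card (nbs G v)) = (\<Sum>v\<in>N. 1 + dN v + dW v)" by (rule sum.cong[OF refl])
  then have "(\<Sum>v\<in>N. card (nbs G v)) = card N + (\<Sum>v\<in>N. dN v) + (\<Sum>v\<in>N. dW v)"
    unfolding sum.distrib by simp
  moreover have "card (nbs G v) = dN v + dW v" if "v \<in> W" for v
    using deg[OF W_less(1)[OF that]] that by (simp add: W_def)
  then have "(\<Sum>v\<in>W. card (nbs G v)) = (\<Sum>v\<in>W. dN v + dW v)" by (rule sum.cong[OF refl])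
  then have "(\<Sum>v\<in>W. card (nbs G v)) = (\<Sum>v\<in>W. dN v) + (\<Sum>v\<in>W. dW v)"
    by (simp add: sum.distrib)
  moreover have "(\<Sum>v\<in>N. dW v) = (\<Sum>v\<in>W. dN v)"
    using sum_nbs_swap[of N W "\<lambda>_. 1 :: nat"] by (simp add: dN_def dW_def)
  ultimately show ?thesis by (simp add: sum_vertices N_def[symmetric])
qed

text \<open>Each neighbour of \<open>w\<close> in \<open>W\<close> has \<open>w\<close> as a
  neighbour in \<open>W\<close>, so the vertices other than \<open>w\<close> contribute at least
  \<open>dW w\<close> once more.\<close>

lemma two_dW_le: "w \<in> W \<Longrightarrow> 2 * dW w \<le> (\<Sum>v\<in>W. dW v)"
proof -
  assume w: "w \<in> W"
  have "dW w = (\<Sum>v\<in>nbs G w \<inter> W. 1)" by (simp add: dW_def)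
  also have "\<dots> \<le> (\<Sum>v\<in>nbs G w \<inter> W. dW v)"
  proof (rule sum_mono)
    fix v assume "v \<in> nbs G w \<inter> W"
    then have "w \<in> nbs G v \<inter> W" using w nbs_sym by auto
    then show "1 \<le> dW v" by (auto simp: dW_def Suc_le_eq card_gt_0_iff)
  qed
  also have "\<dots> \<le> (\<Sum>v\<in>W - {w}. dW v)" using nbs_less by (intro sum_mono2) auto
  finally show ?thesis using sum.remove[OF _ w, of dW] by simp
qed

lemma sum_x_le:
  assumes "\<And>v. v \<in> A \<Longrightarrow> x v \<le> b"
  shows "(\<Sum>v\<in>A. x v) \<le> real (card A) * b"
  using sum_bounded_above[of A x b] assms by simp

text \<open>The edge bound limits the number of edges inside \<^term>\<open>W\<close>, so all entries of \<^term>\<open>x\<close> on \<^term>\<open>W\<close> are small,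
  and each vertex of \<^term>\<open>W\<close> costs at least 1/2 against \<open>n - 1\<close> in the count of walks of length two
  from \<^term>\<open>u\<close>. This bounds \<^term>\<open>W\<close>, hence makes the entries on \<^term>\<open>N\<close> small as well, and then a
  single vertex in \<^term>\<open>W\<close> already costs too much.\<close>

lemma W_empty:
  fixes M s t c :: nat and D :: real
  assumes lam: "real n - 1 \<le> lam\<^sup>2"
    and edges: "(\<Sum>v<n. card (nbs G v)) \<le> 2 * (n - 1) + 2 * c"
    and M: "(\<Sum>v\<in>N. dN v) \<le> M" and s: "\<And>v. v \<in> N \<Longrightarrow> dN v \<le> s" and t: "\<And>v. v \<in> W \<Longrightarrow> dN v \<le> t"
    and D: "D = t + c + M / 2" "t * (D / lam) \<le> 1 / 2"
    and small: "M * ((1 + s + 2 * M * (D / lam)) / lam) < 1 / 2"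
  shows "W = {}"
proof (rule ccontr)
  assume ne: "W \<noteq> {}"
  have n1: "real n - 1 = card N + card W" using order_eq by simp
  have M': "(\<Sum>v\<in>N. real (dN v)) \<le> M" using M by (metis of_nat_le_iff of_nat_sum)
  have DL: "0 \<le> D / lam" using D(1) lam_pos by simp
  have leN: "(\<Sum>v\<in>N. dN v * x v) \<le> M * b" if "\<And>v. v \<in> N \<Longrightarrow> x v \<le> b" "0 \<le> b" for b :: real
  proof -
    have "(\<Sum>v\<in>N. dN v * x v) \<le> (\<Sum>v\<in>N. dN v * b)" using that by (intro sum_mono mult_left_mono) auto
    also have "\<dots> = (\<Sum>v\<in>N. real (dN v)) * b" by (simp add: sum_distrib_right)
    also have "\<dots> \<le> M * b" using M' that(2) by (intro mult_right_mono) auto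
    finally show ?thesis .
  qed
  have "(\<Sum>v\<in>W. dN v * x v) \<le> (\<Sum>v\<in>W. real (dN v))"
    using x_le_1 W_less by (intro sum_mono mult_left_le) auto
  moreover have "(\<Sum>v\<in>N. dN v * x v) \<le> M" using leN[of 1] x_le_1 N_less by simp
  moreover have "(\<Sum>v\<in>N. dN v * x v) \<le> (\<Sum>v\<in>N. real (dN v))"
    using x_le_1 N_less by (intro sum_mono mult_left_le) auto
  ultimately have "lam\<^sup>2 \<le> card N + (\<Sum>v\<in>N. real (dN v)) + (\<Sum>v\<in>W. real (dN v))"
    using lam_sq_le by linarith
  then have "real n - 1 \<le> real (card N + (\<Sum>v\<in>N. dN v) + (\<Sum>v\<in>W. dN v))" using lam by simp
  then have "n - 1 \<le> card N + (\<Sum>v\<in>N. dN v) + (\<Sum>v\<in>W. dN v)" by linarith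
  \<comment> \<open>The edge bound counts edges inside \<open>N\<close> with weight one and the walk
    bound with weight two, so comparing them leaves at most \<open>c + M / 2\<close> edges inside
    \<open>W\<close>. By \<open>two_dW_le\<close>, a vertex of \<open>W\<close> then has degree at
    most \<open>D = t + c + M / 2\<close>.\<close>
  then have dW: "(\<Sum>v\<in>W. dW v) \<le> 2 * c + M"
    using edges M unfolding sum_degrees by linarith
  have xW: "x w \<le> D / lam" if w: "w \<in> W" for w
  proof -
    have wn: "w < n" "w \<notin> N" using w by (auto simp: W_def)
    have "real (card (nbs G w)) = dN w + dW w"
      using sum_nbs_split[OF wn(1), of "\<lambda>_. 1 :: nat"] wn by (simp add: dN_def dW_def)
    also have "\<dots> \<le> D" using t[OF w] two_dW_le[OF w] dW unfolding D(1) by linarith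
    finally have "real (card (nbs G w)) \<le> D" .
    moreover have "(\<Sum>v\<in>nbs G w. x v) \<le> real (card (nbs G w)) * 1"
      by (rule sum_x_le) (rule x_le_1[OF nbs_less(1)])
    then have "lam * x w \<le> card (nbs G w)" using sub[OF wn(1)] by simp
    ultimately show ?thesis using lam_pos by (simp add: field_simps)
  qed
  have half: "(\<Sum>v\<in>W. dN v * x v) \<le> card W * (1 / 2)"
  proof -
    have "dN v * x v \<le> 1 / 2" if "v \<in> W" for v
    proof -
      have "dN v * x v \<le> t * (D / lam)"
        using t[OF that] xW[OF that] x_nonneg W_less that by (intro mult_mono) auto
      then show ?thesis using D(2) by linarith
    qed
    then show ?thesis using sum_bounded_above[of W "\<lambda>v. dN v * x v" "1/2"] by simp
  qed
  \<comment> \<open>Each vertex of \<open>W\<close> is worth 1 on the left but at most 1/2 on the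
    right, so \<open>M\<close> has to pay for the difference.\<close>
  then have "card N + card W \<le> card N + real M + card W * (1 / 2)"
    using lam_sq_le lam n1 \<open>(\<Sum>v\<in>N. dN v * x v) \<le> M\<close> by linarith
  then have cW: "real (card W) \<le> 2 * M" by simp
  have xN: "x v \<le> (1 + s + 2 * M * (D / lam)) / lam" if v: "v \<in> N" for v
  proof -
    have vn: "v < n" using N_less v by auto
    have "(\<Sum>w\<in>nbs G v \<inter> N. x w) \<le> real (card (nbs G v \<inter> N)) * 1"
      by (rule sum_x_le) (simp add: x_le_1 N_less(1))
    also have "\<dots> \<le> s" using s[OF v] by (simp add: dN_def)
    finally have 1: "(\<Sum>w\<in>nbs G v \<inter> N. x w) \<le> s" .
    have "(\<Sum>w\<in>nbs G v \<inter> W. x w) \<le> card (nbs G v \<inter> W) * (D / lam)"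
      using xW by (intro sum_x_le) auto
    also have "\<dots> \<le> card W * (D / lam)"
      using DL by (intro mult_right_mono) (auto intro: card_mono)
    also have "\<dots> \<le> 2 * M * (D / lam)" using DL cW by (intro mult_right_mono) auto
    finally have 2: "(\<Sum>w\<in>nbs G v \<inter> W. x w) \<le> 2 * M * (D / lam)" .
    have "lam * x v \<le> 1 + s + 2 * M * (D / lam)"
      using sub[OF vn] 1 2 v unfolding sum_nbs_split[OF vn] by (simp add: x_u)
    then show ?thesis using lam_pos by (simp add: field_simps)
  qed
  have "(\<Sum>v\<in>N. dN v * x v) \<le> M * ((1 + s + 2 * M * (D / lam)) / lam)"
  proof (rule leN)
    show "0 \<le> (real (1 + s) + real (2 * M) * (D / lam)) / lam"
      using D(1) lam_pos by (intro divide_nonneg_nonneg add_nonneg_nonneg mult_nonneg_nonneg) auto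
  qed (use xN in auto)
  \<comment> \<open>One vertex of \<open>W\<close> loses at least 1/2, while by \<open>small\<close>
    the edges inside \<open>N\<close> now gain less than 1/2.\<close>
  moreover have "real (card W) \<ge> 1" using ne by (simp add: Suc_le_eq card_gt_0_iff)
  ultimately show False using lam_sq_le lam n1 half small by linarith
qed

text \<open>The largest entry \<open>b\<close> on \<open>N\<close> satisfies
  \<open>lam * b <= 1 + s * b\<close>. Inserting \<open>b <= 1 / (lam - s)\<close> into the
  inequality at each vertex of \<open>N\<close>, and the result into \<open>lam_sq_le\<close>, gives
  the expansion to second order.\<close>

lemma lam_sq_le_if_W_empty:
  assumes W: "W = {}" and s: "\<And>v. v \<in> N \<Longrightarrow> dN v \<le> s" "real s < lam"
  shows "lam\<^sup>2 \<le> real n - 1 + ((\<Sum>v\<in>N. dN v) + (\<Sum>v\<in>N. (dN v)\<^sup>2) / (lam - s)) / lam"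
proof -
  have step: "lam * x v \<le> 1 + dN v * b" if v: "v \<in> N" and b: "\<And>w. w \<in> N \<Longrightarrow> x w \<le> b" for v and b :: real
  proof -
    have vn: "v < n" using N_less v by auto
    have "(\<Sum>w\<in>nbs G v \<inter> N. x w) \<le> card (nbs G v \<inter> N) * b" using b by (intro sum_x_le) auto
    then show ?thesis using sub[OF vn] v W unfolding sum_nbs_split[OF vn] by (simp add: x_u dN_def)
  qed
  have x_N: "x v \<le> 1 / (lam - s)" if v: "v \<in> N" for v
  proof -
    define b where "b = Max (x ` N)"
    have bN: "x w \<le> b" if "w \<in> N" for w unfolding b_def using that by auto
    have "b \<in> x ` N" unfolding b_def using v by (intro Max_in) auto
    then obtain z where z: "z \<in> N" "x z = b" by auto
    have "lam * b \<le> 1 + dN z * b" using step[OF z(1) bN] z(2) by simp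
    also have "dN z * b \<le> s * b" using s(1)[OF z(1)] x_nonneg N_less z by (intro mult_right_mono) auto
    finally have "b * (lam - s) \<le> 1" by (simp add: algebra_simps)
    then have "b \<le> 1 / (lam - s)" using s(2) by (simp add: pos_le_divide_eq)
    then show ?thesis using bN[OF v] by simp
  qed
  have "lam * (\<Sum>v\<in>N. dN v * x v) = (\<Sum>v\<in>N. dN v * (lam * x v))"
    by (simp add: sum_distrib_left mult_ac)
  also have "\<dots> \<le> (\<Sum>v\<in>N. dN v * (1 + dN v * (1 / (lam - s))))"
    by (intro sum_mono mult_left_mono step x_N) simp_all
  also have "\<dots> = (\<Sum>v\<in>N. dN v) + (\<Sum>v\<in>N. (dN v)\<^sup>2) / (lam - s)"
    by (simp add: algebra_simps sum.distrib sum_divide_distrib power2_eq_square)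
  finally have "(\<Sum>v\<in>N. dN v * x v) \<le> ((\<Sum>v\<in>N. dN v) + (\<Sum>v\<in>N. (dN v)\<^sup>2) / (lam - s)) / lam"
    using lam_pos by (simp add: field_simps)
  then show ?thesis using lam_sq_le order_eq W by simp
qed

lemma lam_sq_le_if_no_short_cycle:
  assumes "\<And>a b c. distinct [a, b, c] \<Longrightarrow> \<not> tri a b c \<subseteq> {(a, b). G a b}"
    and "\<And>a b c d. distinct [a, b, c, d] \<Longrightarrow> \<not> quad a b c d \<subseteq> {(a, b). G a b}"
  shows "lam\<^sup>2 \<le> real n - 1"
proof -
  let ?E = "{(a, b). G a b}"
  have nb: "?E `` {v} = nbs G v" for v by (auto simp: nbs_def)
  have "(\<Sum>a\<in>?E `` {u}. \<Sum>w\<in>?E `` {a}. x w) \<le> real (card {..<n}) - 1"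
  proof (rule sum_walks2_le)
    show "?E \<subseteq> {..<n} \<times> {..<n}" "sym ?E" "irrefl ?E"
      using G by (auto simp: simple_graph_def sym_def irrefl_def)
  qed (use assms u x_nonneg x_le_1 in auto)
  then show ?thesis using lam_sq_le_walks unfolding nb N_def by simp
qed

end

section \<open>The extremal graph\<close>

lemma simple_graph_extremal: "simple_graph n (extremal_graph k n)"
  by (auto simp: simple_graph_def extremal_graph_def friendship_edge_def insert_commute)

text \<open>The right side of \<open>le\<close> is \<open>r\<close> times the sum of
  \<open>y\<close> over all vertices except 0, so \<open>le\<close> is precisely what makes
  \<open>y\<close> a subsolution at the apex. At the other vertices the inequality holds because the
  truncated expansion only drops nonnegative terms.\<close>

lemma le_rho_extremal:
  fixes r :: real
  assumes r: "r > 0" and k: "k = m + 1" "2 * k \<le> n"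
    and le: "r\<^sup>2 \<le> real n - 1 + 6 * real m / r + 4 * real m * (real m + 2) / r\<^sup>2"
  shows "r \<le> rho n (extremal_graph k n)"
proof -
  let ?E = "extremal_graph k n"
  \<comment> \<open>\<open>y\<close> is the expansion of \<open>(r - A)^{-1} 1\<close> to order \<open>r^{-3}\<close>, where \<open>A\<close> is the adjacency matrix of \<open>H\<close>.\<close>
  define c where "c = 1 / r + 2 * m / r ^ 2 + 4 * m / r ^ 3"
  define b where "b = 1 / r + 2 / r ^ 2 + 2 * k / r ^ 3"
  define y where "y = (\<lambda>v :: nat. if v = 0 then 1 else if v = 1 then c else if v < 2 * k then b else 1 / r)"
  have y0: "0 \<le> y v" for v using r by (simp add: y_def c_def b_def)
  have b_ge: "1 / r + 2 / r ^ 2 \<le> b" and c_ge: "1 / r + 2 * m / r ^ 2 \<le> c"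
    using r by (simp_all add: b_def c_def)
  have fin: "finite (nbs ?E v)" for v using finite_nbs[OF simple_graph_extremal] .
  have y_nbs: "(\<Sum>w\<in>A. y w) \<le> (\<Sum>w\<in>nbs ?E v. y w)" if "A \<subseteq> nbs ?E v" for A v
    using that y0 fin by (intro sum_mono2) auto
  show ?thesis
  proof (rule le_rhoI[OF simple_graph_extremal, of n y 0])
    fix v assume v: "v < n"
    consider "v = 0" | "v = 1" | "2 \<le> v" "v < 2 * k" | "2 * k \<le> v" by linarith
    then show "r * y v \<le> (\<Sum>w\<in>nbs ?E v. y w)"
    proof cases
      case 1
      have "{1..<n} = insert 1 ({2..<2 * k} \<union> {2 * k..<n})" using k by auto
      then have "(\<Sum>w\<in>{1..<n}. y w) = c + ((\<Sum>w\<in>{2..<2 * k}. b) + (\<Sum>w\<in>{2 * k..<n}. 1 / r))"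
      proof -
        have "(\<Sum>w\<in>{2..<2 * k} \<union> {2 * k..<n}. y w) = (\<Sum>w\<in>{2..<2 * k}. y w) + (\<Sum>w\<in>{2 * k..<n}. y w)"
          by (intro sum.union_disjoint) auto
        also have "(\<Sum>w\<in>{2..<2 * k}. y w) = (\<Sum>w\<in>{2..<2 * k}. b)"
          by (intro sum.cong) (auto simp: y_def)
        also have "(\<Sum>w\<in>{2 * k..<n}. y w) = (\<Sum>w\<in>{2 * k..<n}. 1 / r)"
          using k by (intro sum.cong) (auto simp: y_def)
        finally show ?thesis
          using k \<open>{1..<n} = insert 1 ({2..<2 * k} \<union> {2 * k..<n})\<close> by (simp add: y_def)
      qed
      also have "\<dots> = c + 2 * real m * b + (real n - 2 * real k) / r"
        using k by (simp add: of_nat_diff)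
      also have "\<dots> = (real n - 1 + 6 * real m / r + 4 * real m * (real m + 2) / r\<^sup>2) / r"
        using r by (simp add: k(1) b_def c_def field_simps power2_eq_square power3_eq_cube)
      finally have "r \<le> (\<Sum>w\<in>{1..<n}. y w)"
        using le r by (simp add: pos_le_divide_eq power2_eq_square)
      moreover have "{1..<n} \<subseteq> nbs ?E v" using 1 v by (auto simp: nbs_def extremal_graph_def)
      ultimately show ?thesis using y_nbs[of "{1..<n}" v] 1 by (simp add: y_def)
    next
      case 2
      have "insert 0 {2..<2 * k} \<subseteq> nbs ?E v"
        using 2 v k by (auto simp: nbs_def extremal_graph_def friendship_edge_def)
      then have "(\<Sum>w\<in>insert 0 {2..<2 * k}. y w) \<le> (\<Sum>w\<in>nbs ?E v. y w)" by (rule y_nbs)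
      moreover have "(\<Sum>w\<in>insert 0 {2..<2 * k}. y w) = 1 + (\<Sum>w\<in>{2..<2 * k}. b)"
      proof -
        have "(\<Sum>w\<in>{2..<2 * k}. y w) = (\<Sum>w\<in>{2..<2 * k}. b)"
          by (intro sum.cong) (auto simp: y_def)
        then show ?thesis by (simp add: y_def)
      qed
      moreover have "1 + (\<Sum>w\<in>{2..<2 * k}. b) = 1 + 2 * real m * b" by (simp add: k(1))
      moreover have "r * c \<le> 1 + 2 * real m * (1 / r + 2 / r ^ 2)"
        using r by (simp add: c_def field_simps power2_eq_square power3_eq_cube)
      moreover have "2 * real m * (1 / r + 2 / r ^ 2) \<le> 2 * real m * b" using b_ge by (intro mult_left_mono) auto
      moreover have "r * y v = r * c" using 2 by (simp add: y_def)
      ultimately show ?thesis by linarith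
    next
      case 3
      \<comment> \<open>\<open>p\<close> is the third vertex of the triangle of \<open>F_m\<close>
        through 1 and \<open>v\<close>; the outer vertices are paired as \<open>2 * i\<close> and
        \<open>2 * i + 1\<close>.\<close>
      define p where "p = (if even v then v + 1 else v - 1)"
      have p: "2 \<le> p" "p < 2 * k" "p \<noteq> v"
        using 3 by (auto simp: p_def elim!: evenE oddE)
      have "\<exists>i. 1 \<le> i \<and> i \<le> k - 1 \<and> {v, p} = {2 * i, 2 * i + 1}"
        using 3 by (intro exI[of _ "v div 2"]) (auto simp: p_def elim!: evenE oddE)
      then have "{0, 1, p} \<subseteq> nbs ?E v"
        using 3 p v k by (auto simp: nbs_def extremal_graph_def friendship_edge_def)
      then have "(\<Sum>w\<in>{0, 1, p}. y w) \<le> (\<Sum>w\<in>nbs ?E v. y w)" by (rule y_nbs)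
      moreover have "(\<Sum>w\<in>{0, 1, p}. y w) = 1 + c + b" using p by (simp add: y_def)
      moreover have "r * b \<le> 1 + (1 / r + 2 * m / r ^ 2) + (1 / r + 2 / r ^ 2)"
        using r by (simp add: b_def k(1) field_simps power2_eq_square power3_eq_cube)
      ultimately show ?thesis using 3 b_ge c_ge by (simp add: y_def)
    next
      case 4
      then have "{0} \<subseteq> nbs ?E v" using k v by (auto simp: nbs_def extremal_graph_def)
      then have "(\<Sum>w\<in>{0}. y w) \<le> (\<Sum>w\<in>nbs ?E v. y w)" by (rule y_nbs)
      then show ?thesis using 4 k r by (simp add: y_def)
    qed
  qed (use k y0 in \<open>auto simp: y_def\<close>)
qed

text \<open>By continuity the strict inequality persists for some \<open>z > r\<close>, to which
  \<open>le_rho_extremal\<close> applies.\<close>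

lemma less_rho_extremal:
  fixes r :: real
  assumes r: "r > 0" and k: "k = m + 1" "2 * k \<le> n"
    and less: "r\<^sup>2 < real n - 1 + 6 * real m / r + 4 * real m * (real m + 2) / r\<^sup>2"
  shows "r < rho n (extremal_graph k n)"
proof -
  let ?f = "\<lambda>r. real n - 1 + 6 * real m / r + 4 * real m * (real m + 2) / r\<^sup>2 - r\<^sup>2"
  have "isCont ?f r" using r by (intro continuous_intros) auto
  then have "(?f \<longlongrightarrow> ?f r) (at_right r)"
    by (simp add: isCont_def filterlim_at_split)
  then have "eventually (\<lambda>z. 0 < ?f z) (at_right r)"
    using less by (intro order_tendstoD(1)) auto
  then obtain b where b: "b > r" "\<And>z. r < z \<Longrightarrow> z < b \<Longrightarrow> 0 < ?f z"
    unfolding eventually_at_right_field by auto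
  obtain z where "r < z" "z < b" using dense[OF b(1)] by auto
  with b(2) have z: "z > r" "0 < ?f z" by auto
  then have "z \<le> rho n (extremal_graph k n)" using r k by (intro le_rho_extremal) auto
  with z show ?thesis by simp
qed

section \<open>Comparison with the extremal graph\<close>

text \<open>Consecutive pairs of common neighbours form 4-cycles with \<open>u\<close> and
  \<open>w\<close>. This yields the bound \<open>2 * k - 1\<close> on the number of neighbours that
  a vertex shares with \<open>u\<close>.\<close>

lemma packs_common_neighbours:
  assumes "sym E" "irrefl E" "u \<noteq> w" "distinct xs" "length xs = 2 * k"
    and "\<And>p. p \<in> set xs \<Longrightarrow> (u, p) \<in> E \<and> (w, p) \<in> E"
  shows "packs k E"
  using assms
proof (induction k arbitrary: xs E)
  case (Suc k)
  then obtain p q ys where xs: "xs = p # q # ys" by (auto simp: length_Suc_conv)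
  let ?F = "quad u p w q"
  have e: "(u, p) \<in> E" "(w, p) \<in> E" "(u, q) \<in> E" "(w, q) \<in> E" using Suc.prems(6) xs by auto
  then have e': "(p, u) \<in> E" "(p, w) \<in> E" "(q, u) \<in> E" "(q, w) \<in> E" using Suc.prems(1) by (auto dest: symD)
  have ne: "p \<noteq> u" "p \<noteq> w" "q \<noteq> u" "q \<noteq> w" using e Suc.prems(2) by (auto simp: irrefl_def)
  have F: "leafless ?F" using ne xs Suc.prems(3,4) by (intro leafless_quad) auto
  have FE: "?F \<subseteq> E" using e e' by (auto simp: quad_def)
  have "packs k (E - ?F)"
  proof (rule Suc.IH[of _ ys])
    show "sym (E - ?F)" using Suc.prems(1) by (auto simp: sym_def quad_def)
    show "irrefl (E - ?F)" using Suc.prems(2) by (auto simp: irrefl_def)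
    show "distinct ys" "length ys = 2 * k" using Suc.prems(4,5) xs by auto
    show "(u, y) \<in> E - ?F \<and> (w, y) \<in> E - ?F" if "y \<in> set ys" for y
      using Suc.prems(3,4) Suc.prems(6)[of y] that ne xs by (auto simp: quad_def)
  qed (fact Suc.prems(3))
  with F FE show ?case by auto
qed simp

lemma relabel:
  assumes "distinct xs" "set xs \<subseteq> {0..<n}"
  obtains f where "bij_betw f {0..<n} {0..<n}" "\<And>i. i < length xs \<Longrightarrow> f (xs ! i) = i"
proof -
  define l where "l = length xs"
  have len: "card (set xs) = l" using assms by (simp add: distinct_card l_def)
  have "l \<le> n" using card_mono[OF _ assms(2)] len by simp
  have "card ({0..<n} - set xs) = card {l..<n}"
    using assms len by (simp add: card_Diff_subset)
  then obtain h where h: "bij_betw h ({0..<n} - set xs) {l..<n}"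
    using finite_same_card_bij[of "{0..<n} - set xs" "{l..<n}"] by auto
  define g where "g = inv_into {..<l} ((!) xs)"
  have nth: "bij_betw ((!) xs) {..<l} (set xs)"
    using assms by (intro bij_betw_nth) (simp_all add: l_def)
  have g: "bij_betw g (set xs) {..<l}" unfolding g_def using nth by (rule bij_betw_inv_into)
  define f where "f = (\<lambda>v. if v \<in> set xs then g v else h v)"
  have "bij_betw f (set xs) {..<l}"
    using g by (rule iffD1[OF bij_betw_cong, rotated]) (simp add: f_def)
  moreover have "bij_betw f ({0..<n} - set xs) {l..<n}"
    using h by (rule iffD1[OF bij_betw_cong, rotated]) (simp add: f_def)
  ultimately have "bij_betw f (set xs \<union> ({0..<n} - set xs)) ({..<l} \<union> {l..<n})"
    by (rule bij_betw_combine) auto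
  moreover have "set xs \<union> ({0..<n} - set xs) = {0..<n}" "{..<l} \<union> {l..<n} = {0..<n}"
    using assms \<open>l \<le> n\<close> by auto
  moreover have "f (xs ! i) = i" if "i < length xs" for i
    using that bij_betw_inv_into_left[OF nth, of i] by (simp add: f_def g_def l_def)
  ultimately show thesis using that by simp
qed

lemma friendship_edge_1: "\<not> friendship_edge (Suc 0) a b"
  by (auto simp: friendship_edge_def)

lemma friendship_edge_2: "friendship_edge 2 a b \<longleftrightarrow> (a, b) \<in> tri 1 2 3"
proof -
  have i: "1 \<le> i \<and> i \<le> 2 - 1 \<and> Q \<longleftrightarrow> i = 1 \<and> Q" for i :: nat and Q by auto
  have v: "2 \<le> v \<and> v \<le> 2 * 2 - 1 \<longleftrightarrow> v = 2 \<or> v = 3" for v :: nat by auto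
  have "friendship_edge 2 a b \<longleftrightarrow> a = 1 \<and> (b = 2 \<or> b = 3) \<or> b = 1 \<and> (a = 2 \<or> a = 3) \<or> {a, b} = {2, 3}"
    unfolding friendship_edge_def i v by simp
  then show ?thesis by (simp add: tri_def doubleton_eq_iff) blast
qed

lemma friendship_edge_3: "friendship_edge 3 a b \<longleftrightarrow> (a, b) \<in> tri 1 2 3 \<union> tri 1 4 5"
proof -
  have i: "1 \<le> i \<and> i \<le> 3 - 1 \<and> Q \<longleftrightarrow> i = 1 \<and> Q \<or> i = 2 \<and> Q" for i :: nat and Q by auto
  have v: "2 \<le> v \<and> v \<le> 2 * 3 - 1 \<longleftrightarrow> v = 2 \<or> v = 3 \<or> v = 4 \<or> v = 5" for v :: nat by auto
  have "friendship_edge 3 a b \<longleftrightarrow> a = 1 \<and> (b = 2 \<or> b = 3 \<or> b = 4 \<or> b = 5)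
      \<or> b = 1 \<and> (a = 2 \<or> a = 3 \<or> a = 4 \<or> a = 5) \<or> {a, b} = {2, 3} \<or> {a, b} = {4, 5}"
    unfolding friendship_edge_def i v ex_disj_distrib by simp
  then show ?thesis by (auto simp: tri_def doubleton_eq_iff)
qed

section \<open>Graphs with spectral radius at least that of a star, for each
  \<open>k\<close>\<close>

context top_vertex
begin

definition "S = {(a, b). a \<in> N \<and> b \<in> N \<and> G a b}"

abbreviation "E \<equiv> {(a, b). G a b}"

lemma E_props: "finite {..<n}" "E \<subseteq> {..<n} \<times> {..<n}" "sym E" "irrefl E"
  using G by (auto simp: simple_graph_def sym_def irrefl_def)

lemma card_E: "card E = (\<Sum>v<n. card (nbs G v))"
proof -
  have "E `` {v} = nbs G v" for v by (auto simp: nbs_def)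
  then show ?thesis using card_eq_sum_degrees[OF E_props(1,2)] by simp
qed

sublocale cone: cone_graph u N S
  using finite_NW(1) N_less(2) G
  by unfold_locales (simp_all add: S_def sym_def irrefl_def simple_graph_def, auto)

lemma cone_subset: "cone u N S \<subseteq> E"
  using G by (auto simp: S_def cone_def simple_graph_def N_def nbs_def)

lemma not_packs_cone: "\<not> packs k E \<Longrightarrow> \<not> packs k (cone u N S)"
  using packs_mono[OF _ cone_subset] by blast

lemma dN_eq: "v \<in> N \<Longrightarrow> dN v = card (S `` {v})"
  unfolding dN_def by (rule arg_cong[of _ _ card]) (auto simp: S_def nbs_def)

lemma sum_dN: "(\<Sum>v\<in>N. dN v) = card S"
  using card_eq_sum_degrees[OF cone.finite_N cone.S_sub] by (simp add: dN_eq)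

lemma sum_dN_sq: "(\<Sum>v\<in>N. (dN v)\<^sup>2) = (\<Sum>v\<in>N. (card (S `` {v}))\<^sup>2)"
  by (simp add: dN_eq)

lemma dN_le_if_not_packs:
  assumes "\<not> packs k E" "w \<noteq> u" "k \<ge> 1"
  shows "dN w \<le> 2 * k - 1"
proof (rule ccontr)
  assume "\<not> dN w \<le> 2 * k - 1"
  then have "2 * k \<le> card (nbs G w \<inter> N)" using assms(3) by (simp add: dN_def)
  then obtain xs where "length xs = 2 * k" "distinct xs" "set xs \<subseteq> nbs G w \<inter> N"
    by (rule distinct_list_of_card)
  then have "packs k E"
    using assms(2) by (intro packs_common_neighbours[OF E_props(3,4), of u w xs]) (auto simp: nbs_def N_def)
  with assms(1) show False by contradiction
qed

text \<open>The labelling sends \<open>u\<close> to 0 and the entries of \<open>xs\<close> to 1, 2,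
  and so on. The premise on \<open>S\<close> sees of \<open>f\<close> only these labels, so each use
  compares explicit edge lists.\<close>

lemma graph_iso_extremalI:
  assumes W: "W = {}" and xs: "distinct (u # xs)" "set xs \<subseteq> N" and k: "k \<le> n"
    and S: "\<And>f a b. a < n \<Longrightarrow> b < n \<Longrightarrow> (\<And>i v. i < length xs \<Longrightarrow> v < n \<Longrightarrow> f v = Suc i \<longleftrightarrow> v = xs ! i)
      \<Longrightarrow> (a, b) \<in> S \<longleftrightarrow> friendship_edge k (f a) (f b)"
  shows "graph_iso n G (extremal_graph k n)"
proof -
  have sub: "set (u # xs) \<subseteq> {0..<n}" using xs u N_less(1) by auto
  obtain f where f: "bij_betw f {0..<n} {0..<n}" "\<And>i. i < length (u # xs) \<Longrightarrow> f ((u # xs) ! i) = i"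
    using relabel[OF xs(1) sub] by blast
  have inj: "f a = f b \<longleftrightarrow> a = b" if "a < n" "b < n" for a b
    using f(1) that by (auto simp: bij_betw_def inj_on_def)
  have less: "f a < n" if "a < n" for a using bij_betwE[OF f(1)] that by auto
  have f0: "f v = 0 \<longleftrightarrow> v = u" if "v < n" for v
    using f(2)[of 0] inj[OF that u] by simp
  have fS: "f v = Suc i \<longleftrightarrow> v = xs ! i" if "i < length xs" "v < n" for i v
  proof -
    have "xs ! i < n" using that xs(2) N_less(1) nth_mem by blast
    then show ?thesis using f(2)[of "Suc i"] inj[OF that(2), of "xs ! i"] that(1) by simp
  qed
  have "G a b \<longleftrightarrow> extremal_graph k n (f a) (f b)" if ab: "a < n" "b < n" for a b
  proof -
    have "v \<in> N \<or> v = u" if "v < n" for v using W that by (auto simp: W_def)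
    then have "G a b \<longleftrightarrow> a \<noteq> b \<and> (a = u \<or> b = u \<or> (a, b) \<in> S)"
      using ab G by (auto simp: S_def N_def nbs_def simple_graph_def)
    then show ?thesis
      using ab less inj f0 S[OF ab, of f] fS unfolding extremal_graph_def by simp
  qed
  with f(1) show ?thesis unfolding graph_iso_def by blast
qed

lemma graph_iso_extremal_1:
  assumes np: "\<not> packs 1 E" and n: "64 \<le> n" and lam: "real n - 1 \<le> lam\<^sup>2"
  shows "graph_iso n G (extremal_graph 1 n)"
proof -
  have S: "S = {}"
  proof (rule ccontr)
    assume "S \<noteq> {}"
    then obtain a b where ab: "(a, b) \<in> S" by auto
    have "packs 1 (cone u N S)" using cone.edge_tri[OF ab] by auto
    then show False using not_packs_cone[OF np] by contradiction
  qed
  then have dN: "dN v = 0" if "v \<in> N" for v using dN_eq[OF that] by simp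
  have "7\<^sup>2 \<le> lam\<^sup>2" using lam n by simp
  then have lam7: "7 \<le> lam" by (rule power2_le_imp_le) (use lam_pos in simp)
  have "W = {}"
  \<comment> \<open>\<open>G\<close> is a forest, hence \<open>c = 0\<close>;
    \<open>t = 2 * k - 1 = 1\<close> bounds common neighbours with \<open>u\<close>, and
    \<open>D = 1 + 0 + 0\<close>.\<close>
  proof (rule W_empty[where M = 0 and s = 0 and t = 1 and c = 0 and D = 1, OF lam])
    have "card E + 1 < 2 * card {..<n}"
      using leafless_if_many_edges[OF E_props] np u by fastforce
    then show "(\<Sum>v<n. card (nbs G v)) \<le> 2 * (n - 1) + 2 * 0" by (simp add: card_E)
    show "dN v \<le> 1" if "v \<in> W" for v
      using dN_le_if_not_packs[OF np, of v] that W_less(2) by fastforce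
  qed (use lam7 dN in \<open>auto simp: field_simps\<close>)
  then show ?thesis
    by (rule graph_iso_extremalI[of "[]"]) (use n S friendship_edge_1 in auto)
qed

lemma graph_iso_extremal_2_or_less:
  assumes np: "\<not> packs 2 E" and n: "4096 \<le> n" and lam: "real n - 1 \<le> lam\<^sup>2"
  shows "graph_iso n G (extremal_graph 2 n) \<or> lam\<^sup>2 < real n - 1 + 6 * real 1 / lam + 4 * real 1 * (real 1 + 2) / lam\<^sup>2"
proof -
  have "63\<^sup>2 \<le> lam\<^sup>2" using lam n by simp
  then have lam63: "63 \<le> lam" by (rule power2_le_imp_le) (use lam_pos in simp)
  note npc = not_packs_cone[OF np]
  have deg: "dN v \<le> 2" if "v \<in> N" for v
    using cone.degree_le_if_not_packs_2[OF npc] dN_eq[OF that] by simp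
  have S6: "card S \<le> 6"
    using npc by (rule cone.not_packs_2_cases) (use card_tri_le in auto)
  have "10 / lam \<le> 10 / 63" using lam63 by (intro divide_left_mono) auto
  have W: "W = {}"
  \<comment> \<open>\<open>M\<close> is twice the three possible edges inside \<open>N\<close>,
    \<open>t = 2 * k - 1\<close>, the edge bound \<open>n + 3 = (n - 1) + 4\<close> gives
    \<open>c = 4\<close>, and \<open>D = 3 + 4 + 3\<close>.\<close>
  proof (rule W_empty[where M = 6 and s = 2 and t = 3 and c = 4 and D = 10, OF lam])
    have "card E < 2 * card {..<n} + 7"
      using packs_2_if_many_edges[OF E_props] np by fastforce
    then show "(\<Sum>v<n. card (nbs G v)) \<le> 2 * (n - 1) + 2 * 4" using n by (simp add: card_E)
    show "dN v \<le> 3" if "v \<in> W" for v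
      using dN_le_if_not_packs[OF np, of v] that W_less(2) by fastforce
    have "real 6 * ((real (1 + 2) + real (2 * 6) * (10 / lam)) / lam) \<le> 6 * ((3 + 12 * (10 / 63)) / 63)"
      using \<open>10 / lam \<le> 10 / 63\<close> lam63 by (intro mult_mono frac_le) auto
    also have "\<dots> < 1 / 2" by simp
    finally show "real 6 * ((real (1 + 2) + real (2 * 6) * (10 / lam)) / lam) < 1 / 2" .
  qed (use lam63 deg S6 sum_dN in \<open>auto simp: field_simps\<close>)
  show ?thesis
  proof (rule cone.not_packs_2_cases[OF npc])
    fix a b c assume abc: "distinct [a, b, c]" "S = tri a b c"
    have "a \<in> N" "b \<in> N" "c \<in> N" using abc(2) cone.S_sub by (auto simp: tri_def)
    then have "graph_iso n G (extremal_graph 2 n)"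
    proof (intro graph_iso_extremalI[OF W, of "[a, b, c]"])
      fix f x y assume xy: "x < n" "y < n"
        and f: "\<And>i v. i < length [a, b, c] \<Longrightarrow> v < n \<Longrightarrow> f v = Suc i \<longleftrightarrow> v = [a, b, c] ! i"
      have "f v = 1 \<longleftrightarrow> v = a" "f v = 2 \<longleftrightarrow> v = b" "f v = 3 \<longleftrightarrow> v = c" if "v < n" for v
        using f[of 0 v] f[of 1 v] f[of 2 v] that by (simp_all add: eval_nat_numeral)
      then show "(x, y) \<in> S \<longleftrightarrow> friendship_edge 2 (f x) (f y)"
        using xy unfolding abc(2) friendship_edge_2 by (simp add: tri_def)
    qed (use abc n N_less in auto)
    then show ?thesis ..
  next
    \<comment> \<open>With at most two edges in \<open>S\<close> the first-order coefficient drops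
      from 6 to 4, and the second-order term \<open>8 / 61\<close> cannot make up for it.\<close>
    assume S4: "card S \<le> 4"
    have "(\<Sum>v\<in>N. (dN v)\<^sup>2) \<le> (\<Sum>v\<in>N. 2 * dN v)"
      using deg by (intro sum_mono) (simp add: power2_eq_square)
    also have "\<dots> \<le> 8" using S4 by (simp add: sum_distrib_left[symmetric] sum_dN)
    finally have Q: "real (\<Sum>v\<in>N. (dN v)\<^sup>2) \<le> 8" by linarith
    have "lam\<^sup>2 \<le> real n - 1 + ((\<Sum>v\<in>N. dN v) + (\<Sum>v\<in>N. (dN v)\<^sup>2) / (lam - 2)) / lam"
      using lam_sq_le_if_W_empty[OF W, of 2] deg lam63 by simp
    also have "((\<Sum>v\<in>N. dN v) + (\<Sum>v\<in>N. (dN v)\<^sup>2) / (lam - 2)) / lam \<le> (4 + 8 / 61) / lam"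
      using Q S4 lam63 by (intro divide_right_mono add_mono frac_le) (auto simp: sum_dN)
    also have "\<dots> < 6 / lam" using lam63 by (intro divide_strict_right_mono) auto
    finally have "lam\<^sup>2 < real n - 1 + 6 / lam" by simp
    moreover have "0 < 12 / lam\<^sup>2" using lam_pos by simp
    ultimately have "lam\<^sup>2 < real n - 1 + 6 / lam + 12 / lam\<^sup>2" by linarith
    then show ?thesis by simp
  qed
qed

lemma graph_iso_extremal_3_or_less:
  assumes np: "\<not> packs 3 E" and n: "46656 \<le> n" and lam: "real n - 1 < lam\<^sup>2"
  shows "graph_iso n G (extremal_graph 3 n) \<or> lam\<^sup>2 < real n - 1 + 6 * real 2 / lam + 4 * real 2 * (real 2 + 2) / lam\<^sup>2"
proof -
  have "215\<^sup>2 \<le> lam\<^sup>2" using lam n by simp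
  then have lam215: "215 \<le> lam" by (rule power2_le_imp_le) (use lam_pos in simp)
  note npc = not_packs_cone[OF np]
  have deg: "card (S `` {v}) \<le> 4" for v using cone.degree_le_if_not_packs_3[OF npc] .
  then have deg': "dN v \<le> 4" if "v \<in> N" for v using dN_eq[OF that] by simp
  have cases: "(\<exists>c p q r s. distinct [c, p, q, r, s] \<and> S = tri c p q \<union> tri c r s)
      \<or> card S \<le> 10 \<or> (card S \<le> 12 \<and> (\<Sum>v\<in>N. (dN v)\<^sup>2) \<le> 30 \<and> (\<forall>v\<in>N. dN v \<le> 3))"
  proof (cases "\<exists>c. card (S `` {c}) = 4")
    case True
    then obtain c where "card (S `` {c}) = 4" by auto
    with npc show ?thesis by (rule cone.not_packs_3_degree_4_cases) blast+
  next
    case False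
    have "card (S `` {v}) \<le> 3" for v using deg[of v] False le_neq_implies_less[OF deg[of v]] by auto
    then show ?thesis
      using cone.not_packs_3_degree_3_bounds[OF npc] by (simp add: sum_dN_sq dN_eq)
  qed
  have S12: "card S \<le> 12"
    using cases
  proof (elim disjE exE conjE)
    fix c p q r s assume "S = tri c p q \<union> tri c r s"
    then show ?thesis
      using card_Un_le[of "tri c p q" "tri c r s"] card_tri_le[of c p q] card_tri_le[of c r s] by simp
  qed auto
  have "\<exists>F\<subseteq>E. leafless F \<and> card F \<le> 8"
  proof (rule ccontr)
    assume no: "\<not> ?thesis"
    have "lam\<^sup>2 \<le> real n - 1"
    proof (rule lam_sq_le_if_no_short_cycle)
      show "\<not> tri a b c \<subseteq> E" if "distinct [a, b, c]" for a b c
        using no leafless_tri[OF that] card_tri_le[of a b c] by auto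
      show "\<not> quad a b c d \<subseteq> E" if "distinct [a, b, c, d]" for a b c d
        using no leafless_quad[OF that] card_quad_le[of a b c d] by auto
    qed
    with lam show False by simp
  qed
  then obtain F where F: "F \<subseteq> E" "leafless F" "card F \<le> 8" by auto
  have "card (E - F) < 2 * card {..<n} + 7"
  proof (rule ccontr)
    assume "\<not> ?thesis"
    then have "packs 2 (E - F)"
      using E_props F(2) by (intro packs_2_if_many_edges[of "{..<n}"]) (auto simp: sym_def irrefl_def leafless_def)
    then have "packs (Suc 2) E" using F packs_SucI[of F E 2 "E - F"] by blast
    then show False using np by (simp add: numeral_3_eq_3 numeral_2_eq_2)
  qed
  moreover have "finite F" using F(2) by (simp add: leafless_def)
  ultimately have E8: "card E \<le> 2 * (n - 1) + 2 * 8"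
    using F card_Diff_subset[of F E] n by simp
  have "19 / lam \<le> 19 / 215" using lam215 by (intro divide_left_mono) auto
  have W: "W = {}"
  \<comment> \<open>At most \<open>n + 3\<close> edges remain beside a cycle of at most four, so
    there are at most \<open>n + 7 = (n - 1) + 8\<close> and \<open>c = 8\<close>; further
    \<open>t = 2 * 3 - 1\<close> and \<open>D = 5 + 8 + 6\<close>.\<close>
  proof (rule W_empty[where M = 12 and s = 4 and t = 5 and c = 8 and D = 19])
    show "real n - 1 \<le> lam\<^sup>2" using lam by simp
    show "(\<Sum>v<n. card (nbs G v)) \<le> 2 * (n - 1) + 2 * 8" using E8 by (simp add: card_E)
    show "dN v \<le> 5" if "v \<in> W" for v
      using dN_le_if_not_packs[OF np, of v] that W_less(2) by fastforce
    have "real 12 * ((real (1 + 4) + real (2 * 12) * (19 / lam)) / lam) \<le> 12 * ((5 + 24 * (19 / 215)) / 215)"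
      using \<open>19 / lam \<le> 19 / 215\<close> lam215 by (intro mult_mono frac_le) auto
    also have "\<dots> < 1 / 2" by simp
    finally show "real 12 * ((real (1 + 4) + real (2 * 12) * (19 / lam)) / lam) < 1 / 2" .
  qed (use lam215 deg' S12 sum_dN in \<open>auto simp: field_simps\<close>)
  \<comment> \<open>\<open>12 + 32 / lam\<close> is the coefficient that \<open>F_2\<close> attains,
    from its degree sum 12 and its sum of squared degrees 32.\<close>
  have less: ?thesis if "lam\<^sup>2 \<le> real n - 1 + B / lam" "B < 12 + 32 / lam" for B
  proof -
    have "B / lam < (12 + 32 / lam) / lam" using that lam_pos by (intro divide_strict_right_mono)
    also have "\<dots> = 12 / lam + 32 / lam\<^sup>2" by (simp add: add_divide_distrib power2_eq_square)
    finally show ?thesis using that(1) by simp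
  qed
  from cases consider c p q r s where "distinct [c, p, q, r, s]" "S = tri c p q \<union> tri c r s"
    | "card S \<le> 10" | "card S \<le> 12" "(\<Sum>v\<in>N. (dN v)\<^sup>2) \<le> 30" "\<forall>v\<in>N. dN v \<le> 3" by blast
  then show ?thesis
  proof cases
    case (1 c p q r s)
    have "c \<in> N" "p \<in> N" "q \<in> N" "r \<in> N" "s \<in> N" using 1(2) cone.S_sub by (auto simp: tri_def)
    then have "graph_iso n G (extremal_graph 3 n)"
    proof (intro graph_iso_extremalI[OF W, of "[c, p, q, r, s]"])
      fix f x y assume xy: "x < n" "y < n"
        and f: "\<And>i v. i < length [c, p, q, r, s] \<Longrightarrow> v < n \<Longrightarrow> f v = Suc i \<longleftrightarrow> v = [c, p, q, r, s] ! i"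
      have "f v = 1 \<longleftrightarrow> v = c" "f v = 2 \<longleftrightarrow> v = p" "f v = 3 \<longleftrightarrow> v = q" "f v = 4 \<longleftrightarrow> v = r" "f v = 5 \<longleftrightarrow> v = s"
        if "v < n" for v
        using f[of 0 v] f[of 1 v] f[of 2 v] f[of 3 v] f[of 4 v] that by (simp_all add: eval_nat_numeral)
      then show "(x, y) \<in> S \<longleftrightarrow> friendship_edge 3 (f x) (f y)"
        using xy unfolding 1(2) friendship_edge_3 by (simp add: tri_def)
    qed (use 1 n N_less in auto)
    then show ?thesis ..
  next
    case 2
    have "(\<Sum>v\<in>N. (dN v)\<^sup>2) \<le> (\<Sum>v\<in>N. 4 * dN v)"
      using deg' by (intro sum_mono) (simp add: power2_eq_square)
    also have "\<dots> \<le> 40" using 2 by (simp add: sum_distrib_left[symmetric] sum_dN)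
    finally have Q: "real (\<Sum>v\<in>N. (dN v)\<^sup>2) \<le> 40" by linarith
    have "(\<Sum>v\<in>N. dN v) + (\<Sum>v\<in>N. (dN v)\<^sup>2) / (lam - 4) \<le> 10 + 40 / 211"
      using Q 2 lam215 by (intro add_mono frac_le) (auto simp: sum_dN)
    also have "\<dots> < 12 + 32 / lam" using lam_pos by (simp add: add_strict_increasing)
    finally show ?thesis
      using lam_sq_le_if_W_empty[OF W, of 4] deg' lam215 by (intro less) auto
  next
    case 3
    have "real (\<Sum>v\<in>N. (dN v)\<^sup>2) \<le> 30" using 3(2) by linarith
    then have "(\<Sum>v\<in>N. dN v) + (\<Sum>v\<in>N. (dN v)\<^sup>2) / (lam - 3) \<le> 12 + 30 / (lam - 3)"
      using 3(1) lam215 by (intro add_mono divide_right_mono) (auto simp: sum_dN)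
    \<comment> \<open>Equal edge counts are decided at second order:
      \<open>30 / (lam - 3) < 32 / lam\<close> as soon as \<open>lam > 48\<close>.\<close>
    also have "\<dots> < 12 + 32 / lam" using lam215 by (simp add: field_simps)
    finally show ?thesis
      using lam_sq_le_if_W_empty[OF W, of 3] 3(3) lam215 by (intro less) auto
  qed
qed

end

lemma graph_iso_or_rho_less:
  assumes k: "k \<in> {1, 2, 3}" and n: "n \<ge> 64 * k ^ 6" and G: "simple_graph n G"
    and no: "\<not> has_edge_disjoint_cycles G k"
  shows "graph_iso n G (extremal_graph k n) \<or> rho n G < rho n (extremal_graph k n)"
proof -
  obtain m where m: "k = m + 1" using k by (cases k) auto
  have n64: "64 \<le> n" "2 * k \<le> n" using k n by auto
  define lam where "lam = rho n G"
  have np: "\<not> packs k {(a, b). G a b}"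
  proof
    assume "packs k {(a, b). G a b}"
    then have "has_edge_disjoint_cycles G k" by (rule packs_imp_edge_disjoint_cycles) simp
    with no show False by contradiction
  qed
  have lam0: "0 \<le> lam" using rho_nonneg[OF G] n64 by (simp add: lam_def)
  \<comment> \<open>\<open>?r\<close> is the spectral radius of a star. For \<open>k = 1\<close> the
    star is extremal, so \<open>lam = ?r\<close> must be settled by structure. For larger
    \<open>k\<close> the extremal graph lies strictly above \<open>?r\<close>, which disposes of
    equality and leaves the strict inequality that forces a short cycle when
    \<open>k = 3\<close>.\<close>
  let ?r = "sqrt (real n - 1)"
  have r: "0 < ?r" "?r\<^sup>2 = real n - 1" using n64 by auto
  have lam_le: "lam \<le> ?r" if "lam\<^sup>2 \<le> real n - 1" using that by (rule real_le_rsqrt)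
  consider "lam\<^sup>2 < real n - 1" | "lam\<^sup>2 = real n - 1" "k \<noteq> 1" | "real n - 1 \<le> lam\<^sup>2" "k \<noteq> 1 \<longrightarrow> real n - 1 < lam\<^sup>2"
    by fastforce
  then show ?thesis
  proof cases
    case 1
    then have "lam < ?r" by (rule real_less_rsqrt)
    also have "?r \<le> rho n (extremal_graph k n)"
      using r m n64 by (intro le_rho_extremal[of _ k m]) auto
    finally show ?thesis by (simp add: lam_def)
  next
    case 2
    then have "lam \<le> ?r" using lam_le by simp
    also have "?r < rho n (extremal_graph k n)"
    proof (rule less_rho_extremal[OF r(1) m n64(2)])
      have "0 < 6 * real m / ?r" using r(1) 2 m by simp
      moreover have "0 \<le> 4 * real m * (real m + 2) / ?r\<^sup>2" using r by simp
      ultimately show "?r\<^sup>2 < real n - 1 + 6 * real m / ?r + 4 * real m * (real m + 2) / ?r\<^sup>2"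
        unfolding r(2) by linarith
    qed
    finally show ?thesis by (simp add: lam_def)
  next
    case 3
    have "0 < lam\<^sup>2" using 3(1) n64 by linarith
    then have lam_pos: "0 < lam" using lam0 by (cases "lam = 0") auto
    obtain x :: "nat \<Rightarrow> real" and u where "u < n" "x u = 1" "\<And>v. v < n \<Longrightarrow> 0 \<le> x v"
      "\<And>v. v < n \<Longrightarrow> x v \<le> 1" "\<And>v. v < n \<Longrightarrow> rho n G * x v \<le> (\<Sum>w\<in>nbs G v. x w)"
      using rho_le_nbs_sum[OF G] n64 by (metis gr0I not_numeral_le_zero)
    then interpret top_vertex n G lam x u
      using G lam_pos by unfold_locales (auto simp: lam_def)
    have less: ?thesis
      if "graph_iso n G (extremal_graph k n) \<or> lam\<^sup>2 < real n - 1 + 6 * real m / lam + 4 * real m * (real m + 2) / lam\<^sup>2"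
      using that less_rho_extremal[OF lam_pos m n64(2)] by (auto simp: lam_def)
    from k consider "k = 1" | "k = 2" | "k = 3" by auto
    then show ?thesis
    proof cases
      case k1: 1
      then show ?thesis using graph_iso_extremal_1 np n64 3(1) by simp
    next
      case k2: 2
      have np': "\<not> packs 2 E" using np unfolding k2 .
      have n': "4096 \<le> n" using n unfolding k2 by simp
      have "m = 1" using m k2 by simp
      then show ?thesis
        using graph_iso_extremal_2_or_less[OF np' n' 3(1)] by (intro less) (simp only: k2)
    next
      case k3: 3
      have np': "\<not> packs 3 E" using np unfolding k3 .
      have n': "46656 \<le> n" using n unfolding k3 by simp
      have strict: "real n - 1 < lam\<^sup>2" using 3(2) k3 by simp
      have "m = 2" using m k3 by simp
      then show ?thesis
        using graph_iso_extremal_3_or_less[OF np' n' strict] by (intro less) (simp only: k3)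
    qed
  qed
qed

theorem theorem5p2:
  fixes k n :: nat and G :: "nat \<Rightarrow> nat \<Rightarrow> bool"
  assumes "k \<in> {1, 2, 3}"
    and "n \<ge> 64 * k ^ 6"
    and "simple_graph n G"
    and "\<not> has_edge_disjoint_cycles G k"
  shows "rho n G \<le> rho n (extremal_graph k n)
    \<and> (rho n G = rho n (extremal_graph k n) \<longleftrightarrow> graph_iso n G (extremal_graph k n))"
proof -
  have "n > 0" using assms(1,2) by auto
  then show ?thesis
    using graph_iso_or_rho_less[OF assms] rho_graph_iso[OF assms(3) simple_graph_extremal] by force
qed

end
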